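(* Let $\mathbf{Z}$ be a Prüfer domain of dimension $\le1$ with explicit divisibility. Let $M\in\mathbf{Z}^{n\times m}$ be a matrix with $\mathfrak{D}_n(M)\neq0$, where $\mathfrak{D}_n(M)$ is the ideal generated by the $n\times n$ minors of $M$, and let $\delta$ be a nonzero element of $\mathfrak{D}_n(M)$. Then $M$, viewed as a pseudo-matrix with all row and column indices equal to $\langle1\rangle$, is equivalent to a pseudo-matrix of the form $$M_1=\big(\langle1\rangle,\dots,\langle1\rangle;\ \mathfrak{a}_1,\dots,\mathfrak{a}_n,\dots,\mathfrak{a}_m;\ [\,\mathrm{I}_n\mid 0\,]\big)$$ with $\mathfrak{a}_1\supseteq\mathfrak{a}_2\supseteq\cdots\supseteq\mathfrak{a}_n$, $\prod_{i=1}^n\mathfrak{a}_i=\mathfrak{D}_n(M)$, each $\mathfrak{a}_i$ for $1\le i\le n$ of the form $\langle a_i,\delta\rangle$ with $a_i\in\mathbf{Z}$, and $\bigoplus_{k=1}^m\mathfrak{a}_k\simeq\mathbf{Z}^m$.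
   Context: A Prüfer domain is an integral domain in which every nonzero finitely generated ideal is invertible; $\mathbf{K}$ is its field of fractions. An integral domain $\mathbf{Z}$ has dimension $\le1$ if for each $b\ne0$ the ring $\mathbf{Z}/\langle b\rangle$ is zero-dimensional, i.e. for each element $a$ there are $k\in\mathbb{N}$ and $x$ with $a^k(1-ax)=0$. "Explicit divisibility" is a constructive convention: there is an algorithm deciding divisibility in $\mathbf{Z}$. A pseudo-matrix over $\mathbf{Z}$ is a triple $M=(\mathfrak{h}_1,\dots,\mathfrak{h}_n;\mathfrak{e}_1,\dots,\mathfrak{e}_m;\underline{M})$ with $\mathfrak{h}_i$ (row indices) and $\mathfrak{e}_j$ (column indices) invertible fractional ideals and $\underline{M}=(m_{ij})\in\mathbf{K}^{n\times m}$ satisfying $m_{ij}\mathfrak{e}_j\subseteq\mathfrak{h}_i$ for all $i,j$. The product is $(\underline{\mathfrak{c}};\underline{\mathfrak{h}};\underline{B})\cdot(\underline{\mathfrak{h}};\underline{\mathfrak{e}};\underline{A})=(\underline{\mathfrak{c}};\underline{\mathfrak{e}};\underline{B}\,\underline{A})$. A pseudo-matrix $(\underline{\mathfrak{h}};\underline{\mathfrak{e}};\underline{M})$ with as many rows as columns is invertible if $\underline{M}$ is invertible and $(\underline{\mathfrak{e}};\underline{\mathfrak{h}};\underline{M}^{-1})$ is a pseudo-matrix. Two pseudo-matrices $A,A'$ are equivalent if $A'=LAC$ for some invertible pseudo-matrices $L,C$. *)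

theory Defs
  imports
    "HOL-Computational_Algebra.Polynomial_Factorial"
    "Jordan_Normal_Form.Determinant"
    "Jordan_Normal_Form.DL_Submatrix"
begin

text \<open>
  The ring \<open>\<^bold>Z\<close> is a type \<open>'a :: idom\<close> and \<open>\<^bold>K\<close> is \<open>'a fract\<close>.  Ideals of \<open>\<^bold>Z\<close> are submodules of
  \<open>'a\<close> (type \<open>'a set\<close>), fractional ideals are \<open>\<^bold>Z\<close>-submodules of \<open>\<^bold>K\<close> (type \<open>'a fract set\<close>); the
  ideal \<open>I\<close> of \<open>\<^bold>Z\<close>, seen as a fractional ideal, is \<open>to_fract ` I\<close>.
\<close>

global_interpretation ideal: Modules.module "(*) :: 'a :: comm_ring_1 \<Rightarrow> 'a \<Rightarrow> 'a"
  by unfold_locales (simp_all only: distrib_left distrib_right mult.assoc mult_1_left)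

global_interpretation fracmod: Modules.module "\<lambda>(r :: 'a :: idom) (x :: 'a fract). to_fract r * x"
  by unfold_locales
    (simp_all only: distrib_left distrib_right mult.assoc mult_1_left to_fract_add to_fract_mult to_fract_1)

text \<open>As simp rules these loop with \<open>algebra_simps\<close> and \<open>ac_simps\<close>.\<close>

declare ideal.scale_scale [simp del] fracmod.scale_scale [simp del]


subsection \<open>Fractional ideals\<close>

definition fractional_ideal :: "'a :: idom fract set \<Rightarrow> bool" where
  "fractional_ideal I \<longleftrightarrow>
     fracmod.subspace I \<and> (\<exists>d. d \<noteq> 0 \<and> (\<forall>x\<in>I. to_fract d * x \<in> range to_fract))"

definition ideal_mult :: "'a :: idom fract set \<Rightarrow> 'a fract set \<Rightarrow> 'a fract set" where
  "ideal_mult I J = fracmod.span {x * y | x y. x \<in> I \<and> y \<in> J}"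

definition unit_ideal :: "'a :: idom fract set" where
  "unit_ideal = fracmod.span {1}"

definition ideal_prod_list :: "'a :: idom fract set list \<Rightarrow> 'a fract set" where
  "ideal_prod_list Is = foldr ideal_mult Is unit_ideal"

definition invertible_ideal :: "'a :: idom fract set \<Rightarrow> bool" where
  "invertible_ideal I \<longleftrightarrow>
     fractional_ideal I \<and> (\<exists>J. fractional_ideal J \<and> ideal_mult I J = unit_ideal)"


subsection \<open>Conditions on the ring\<close>

definition pruefer_domain :: "'a :: idom itself \<Rightarrow> bool" where
  "pruefer_domain (_ :: 'a itself) \<longleftrightarrow>
     (\<forall>S :: 'a set. finite S \<longrightarrow> ideal.span S \<noteq> {0} \<longrightarrow> invertible_ideal (to_fract ` ideal.span S))"

text \<open>
  The quotient ring \<open>\<^bold>Z/I\<close> is zero-dimensional: its elements are represented by elements of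
  \<open>\<^bold>Z\<close>, and an element represents zero iff it lies in \<open>I\<close>.
\<close>

definition zero_dimensional_quotient :: "'a :: comm_ring_1 set \<Rightarrow> bool" where
  "zero_dimensional_quotient I \<longleftrightarrow> (\<forall>a. \<exists>(k::nat) x. a ^ k * (1 - a * x) \<in> I)"

definition dimension_le_1 :: "'a :: idom itself \<Rightarrow> bool" where
  "dimension_le_1 (_ :: 'a itself) \<longleftrightarrow>
     (\<forall>b :: 'a. b \<noteq> 0 \<longrightarrow> zero_dimensional_quotient (ideal.span {b}))"


subsection \<open>Determinantal ideals\<close>

definition det_ideal :: "nat \<Rightarrow> 'a :: comm_ring_1 mat \<Rightarrow> 'a set" where
  "det_ideal k M = ideal.span {det (submatrix M I J) | I J.
     I \<subseteq> {..<dim_row M} \<and> J \<subseteq> {..<dim_col M} \<and> card I = k \<and> card J = k}"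


subsection \<open>Pseudo-matrices\<close>

record 'k pseudo_matrix =
  row_ideals :: "'k set list"
  col_ideals :: "'k set list"
  entries :: "'k mat"

definition is_pseudo_matrix :: "'a :: idom fract pseudo_matrix \<Rightarrow> bool" where
  "is_pseudo_matrix A \<longleftrightarrow>
     (\<forall>I \<in> set (row_ideals A). invertible_ideal I) \<and>
     (\<forall>I \<in> set (col_ideals A). invertible_ideal I) \<and>
     entries A \<in> carrier_mat (length (row_ideals A)) (length (col_ideals A)) \<and>
     (\<forall>i < length (row_ideals A). \<forall>j < length (col_ideals A).
        (\<lambda>x. entries A $$ (i, j) * x) ` (col_ideals A ! j) \<subseteq> row_ideals A ! i)"

text \<open>The product \<open>pseudo_mult B A\<close> is meaningful only if \<open>pseudo_composable B A\<close> holds.\<close>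

definition pseudo_composable :: "'a :: idom fract pseudo_matrix \<Rightarrow> 'a fract pseudo_matrix \<Rightarrow> bool" where
  "pseudo_composable B A \<longleftrightarrow> col_ideals B = row_ideals A"

definition pseudo_mult ::
    "'a :: idom fract pseudo_matrix \<Rightarrow> 'a fract pseudo_matrix \<Rightarrow> 'a fract pseudo_matrix" where
  "pseudo_mult B A =
     \<lparr>row_ideals = row_ideals B, col_ideals = col_ideals A, entries = entries B * entries A\<rparr>"

definition pseudo_invertible :: "'a :: idom fract pseudo_matrix \<Rightarrow> bool" where
  "pseudo_invertible A \<longleftrightarrow>
     is_pseudo_matrix A \<and> length (row_ideals A) = length (col_ideals A) \<and>
     (\<exists>N. inverts_mat (entries A) N \<and> inverts_mat N (entries A) \<and>
          is_pseudo_matrix \<lparr>row_ideals = col_ideals A, col_ideals = row_ideals A, entries = N\<rparr>)"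

definition pseudo_equivalent :: "'a :: idom fract pseudo_matrix \<Rightarrow> 'a fract pseudo_matrix \<Rightarrow> bool" where
  "pseudo_equivalent A A' \<longleftrightarrow>
     is_pseudo_matrix A \<and> is_pseudo_matrix A' \<and>
     (\<exists>L C. pseudo_invertible L \<and> pseudo_invertible C \<and>
            pseudo_composable L A \<and> pseudo_composable (pseudo_mult L A) C \<and>
            A' = pseudo_mult (pseudo_mult L A) C)"

definition pseudo_of_mat :: "'a :: idom mat \<Rightarrow> 'a fract pseudo_matrix" where
  "pseudo_of_mat M =
     \<lparr>row_ideals = replicate (dim_row M) unit_ideal,
      col_ideals = replicate (dim_col M) unit_ideal,
      entries = map_mat to_fract M\<rparr>"

definition id_zero_mat :: "nat \<Rightarrow> nat \<Rightarrow> 'a :: {zero, one} mat" where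
  "id_zero_mat n m = mat n m (\<lambda>(i, j). if i = j then 1 else 0)"


subsection \<open>Direct sums of fractional ideals\<close>

definition direct_sum :: "'a :: idom fract set list \<Rightarrow> 'a fract vec set" where
  "direct_sum Is = {v \<in> carrier_vec (length Is). \<forall>k < length Is. v $ k \<in> Is ! k}"

text \<open>\<open>\<^bold>Z\<close>-linear isomorphism between a submodule of \<open>\<^bold>K\<^sup>k\<close> and a submodule of \<open>\<^bold>Z\<^sup>m\<close>.\<close>

definition module_iso :: "'a :: idom fract vec set \<Rightarrow> 'a vec set \<Rightarrow> bool" where
  "module_iso A B \<longleftrightarrow>
     (\<exists>f. bij_betw f A B \<and>
          (\<forall>u\<in>A. \<forall>v\<in>A. f (u + v) = f u + f v) \<and>
          (\<forall>r. \<forall>v\<in>A. f (to_fract r \<cdot>\<^sub>v v) = r \<cdot>\<^sub>v f v))"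

end

(*
  Modulo \<delta> the ring is zero-dimensional and arithmetical, and every question about divisibility can
  be decided separately on the pieces cut out by idempotents.  Hence some combination of the columns
  of M generates, modulo \<delta>, the ideal of all entries of M, and transvections move this ideal into the
  first coordinate.  Repeating this in the remaining coordinates gives L in GL_n(Z) such that L M maps
  Z^m onto a_1 + ... + a_n (a direct sum of ideals <a_i, \<delta>> in the coordinate axes); here one uses
  that the image of M contains \<delta> Z^n.  Over the field of fractions, 2 x 2 invertible pseudo-matrices
  reduce L M by columns to [T | 0], and T^-1 is again an invertible pseudo-matrix.  Finally D_n(M) is
  generated by the determinants of n-tuples of vectors in the image of M, and for a_1 + ... + a_n
  these determinants generate the product of the a_i.
*)

theory Submission
  imports Defs
begin

subsection \<open>Zero-dimensional arithmetical quotients\<close>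

text \<open>The obstacle is that of two elements neither need divide the other, while the left
  factor has to be invertible over the ring itself: all row ideals stay \<open><1>\<close>, so new
  ideals may enter on the column side only. Division is replaced by the identities
  \<open>s * a = u * b\<close> and \<open>(1 - s) * b = v * a\<close>. Modulo \<delta> the
  coefficients in them lift to idempotents, and "add \<open>b\<close> only where it is needed"
  becomes multiplication by an idempotent \<open>e\<close>, so that \<open>a + e * b\<close> can
  take the place of a greatest common divisor. Errors modulo \<delta> are harmless because every
  vector divisible by \<delta> is already in the image. The inclusions between the ideals cost
  nothing extra: a pivot ideal contains all remaining coordinates of the image, in particular the
  later pivots. Likewise the isomorphism with the free module is the column transformation itself,
  whose row ideals are all \<open><1>\<close>.\<close>

lemma ideal_span_pair: "x \<in> ideal.span {a, b} \<longleftrightarrow> (\<exists>p q. x = p * a + q * (b :: 'a :: comm_ring_1))"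
proof
  assume "x \<in> ideal.span {a, b}"
  then show "\<exists>p q. x = p * a + q * b"
    unfolding ideal.span_insert ideal.span_empty by (auto simp: algebra_simps)
next
  assume "\<exists>p q. x = p * a + q * b"
  then obtain p q where x: "x = p * a + q * b" by blast
  show "x \<in> ideal.span {a, b}"
    unfolding x by (intro ideal.span_add ideal.span_scale ideal.span_base) auto
qed

lemma ideal_span_singleton: "x \<in> ideal.span {a} \<longleftrightarrow> a dvd (x :: 'a :: comm_ring_1)"
  by (auto simp: ideal.span_singleton dvd_def mult.commute)

lemma subspace_dvd:
  assumes "ideal.subspace J" "(d :: 'a :: comm_ring_1) \<in> J" "d dvd x"
  shows "x \<in> J"
  using assms(3) ideal.subspace_scale[OF assms(1,2)] by (auto simp: dvd_def mult.commute)

lemma subspace_cong: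
  assumes "ideal.subspace J" "(d :: 'a :: comm_ring_1) \<in> J" "x \<in> J" "d dvd x - y"
  shows "y \<in> J"
  using ideal.subspace_diff[OF assms(1) assms(3) subspace_dvd[OF assms(1,2,4)]] by simp

text \<open>Modulo \<delta> the powers of \<open>c * x\<close> stabilise, and \<open>e\<close> is
  the stable one: on the part cut out by \<open>e\<close> the element \<open>c\<close> is a unit, on
  the part of \<open>1 - e\<close> it is nilpotent.\<close>

lemma zero_dimensional_idempotent:
  fixes c \<delta> :: "'a :: comm_ring_1"
  assumes "zero_dimensional_quotient (ideal.span {\<delta>})"
  shows "\<exists>e y k. \<delta> dvd e * e - e \<and> \<delta> dvd e - c * y \<and> \<delta> dvd (1 - e) * c ^ k"
proof -
  obtain k x where kx: "\<delta> dvd c ^ k * (1 - c * x)"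
    using assms unfolding zero_dimensional_quotient_def ideal_span_singleton by blast
  have *: "\<delta> dvd c ^ Suc k * (1 - (c * x) ^ j)" for j
  proof -
    have "1 - c * x dvd 1 - (c * x) ^ j"
      by (metis dvd_triv_left one_diff_power_eq)
    then have "c ^ k * (1 - c * x) dvd c ^ k * (1 - (c * x) ^ j)"
      by (rule mult_dvd_mono[OF dvd_refl])
    then have "\<delta> dvd c * (c ^ k * (1 - (c * x) ^ j))"
      using kx by (meson dvd_mult dvd_trans)
    then show ?thesis by (simp add: mult.assoc)
  qed
  \<comment> \<open>The exponent \<open>Suc k\<close>, rather than \<open>k\<close>, makes
    \<open>e\<close> a literal multiple of \<open>c\<close>, also for \<open>k = 0\<close>.\<close>
  let ?e = "(c * x) ^ Suc k"
  have "?e * ?e - ?e = - (x ^ Suc k) * (c ^ Suc k * (1 - (c * x) ^ Suc k))"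
    unfolding power_mult_distrib by (simp add: algebra_simps)
  then have "\<delta> dvd ?e * ?e - ?e"
    using * by (metis dvd_mult)
  moreover have "?e - c * (x * (c * x) ^ k) = 0" by (simp add: algebra_simps)
  moreover have "\<delta> dvd (1 - ?e) * c ^ Suc k"
    using * by (simp only: mult.commute)
  ultimately show ?thesis by (metis dvd_0_right)
qed

text \<open>
  Locally one of \<open>a\<close>, \<open>b\<close> divides the other.  Modulo \<open>\<delta>\<close> the idempotent \<open>e\<close> cuts out the part where
  \<open>a\<close> is a nilpotent multiple of \<open>b\<close>; on the complementary part \<open>b\<close> is a multiple of \<open>a\<close>.
\<close>

lemma arithmetical_split:
  fixes a b \<delta> :: "'a :: comm_ring_1"
  assumes zd: "zero_dimensional_quotient (ideal.span {\<delta>})"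
    and su: "s * a = u * b" and sv: "(1 - s) * b = v * a"
  shows "\<exists>e c k. \<delta> dvd e * e - e \<and> (1 - e) * b \<in> ideal.span {a, \<delta>} \<and>
    \<delta> dvd e * a - c * b \<and> \<delta> dvd e * c ^ k"
proof -
  obtain e1 y1 k1 where e1: "\<delta> dvd e1 * e1 - e1" "\<delta> dvd e1 - s * y1" "\<delta> dvd (1 - e1) * s ^ k1"
    using zero_dimensional_idempotent[OF zd] by blast
  define c where "c = y1 * u"
  obtain e2 y2 k2 where e2: "\<delta> dvd e2 * e2 - e2" "\<delta> dvd e2 - c * y2" "\<delta> dvd (1 - e2) * c ^ k2"
    using zero_dimensional_idempotent[OF zd] by blast
  \<comment> \<open>What remains of the part of \<open>e1\<close> where \<open>c\<close> is
    nilpotent. On both removed parts \<open>b\<close> is a multiple of \<open>a\<close>: on that of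
    \<open>1 - e1\<close>, \<open>s\<close> is nilpotent, so \<open>1 - s\<close> is a unit and
    \<open>(1 - s) * b = v * a\<close> applies; on that of \<open>e1 * e2\<close>, \<open>c\<close>
    can be inverted.\<close>
  define e where "e = e1 * (1 - e2)"
  have "e * e - e = (1 - e2) * (1 - e2) * (e1 * e1 - e1) + e1 * (e2 * e2 - e2)"
    unfolding e_def by (simp add: algebra_simps)
  then have 1: "\<delta> dvd e * e - e"
    using e1(1) e2(1) by (simp only: dvd_add dvd_mult)
  obtain q where q: "1 - s ^ k1 = (1 - s) * q"
    by (metis one_diff_power_eq)
  obtain w1 where w1: "(1 - e1) * s ^ k1 = \<delta> * w1" using e1(3) by (auto simp: dvd_def)
  obtain w2 where w2: "e2 - c * y2 = \<delta> * w2" using e2(2) by (auto simp: dvd_def)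
  have "(1 - e) * b = (1 - e1) * s ^ k1 * b + (1 - e1) * (1 - s ^ k1) * b
      + e1 * (e2 - c * y2) * b + e1 * y2 * y1 * (u * b)"
    unfolding e_def c_def by (simp add: algebra_simps)
  also have "\<dots> = ((1 - e1) * q * v + e1 * y2 * y1 * s) * a + (w1 * b + e1 * w2 * b) * \<delta>"
  proof -
    have "(1 - e1) * (1 - s ^ k1) * b = (1 - e1) * q * ((1 - s) * b)"
      unfolding q by (simp add: mult_ac)
    then show ?thesis
      unfolding w1 w2 sv su[symmetric] by (simp add: algebra_simps)
  qed
  finally have 2: "(1 - e) * b \<in> ideal.span {a, \<delta>}"
    unfolding ideal_span_pair by blast
  \<comment> \<open>The witness is \<open>(1 - e2) * c\<close> instead of \<open>c\<close>: with
    this factor the congruence holds without multiplying its right-hand side by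
    \<open>e\<close>.\<close>
  have "e * a - (1 - e2) * c * b = (1 - e2) * a * (e1 - s * y1) + (1 - e2) * y1 * (s * a - u * b)"
    unfolding e_def c_def by (simp add: algebra_simps)
  then have 3: "\<delta> dvd e * a - (1 - e2) * c * b"
    using e1(2) su by simp
  have "e * ((1 - e2) * c) ^ k2 = e1 * (1 - e2) ^ k2 * ((1 - e2) * c ^ k2)"
    unfolding e_def power_mult_distrib by (simp add: mult_ac)
  then have 4: "\<delta> dvd e * ((1 - e2) * c) ^ k2"
    using e2(3) by simp
  from 1 2 3 4 show ?thesis by blast
qed

text \<open>Argue modulo \<delta> on the two parts cut out by \<open>e\<close>. On the part of
  \<open>1 - e\<close> the combination \<open>u i + e * w i\<close> is just \<open>u i\<close>;
  these generate \<open>a\<close>, and \<open>b\<close> is a multiple of \<open>a\<close> there. On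
  the part of \<open>e\<close> one has \<open>a = c * b\<close> with \<open>c\<close> nilpotent, so
  \<open>u i\<close> is a nilpotent multiple of \<open>b\<close>, and \<open>u i + w i\<close>
  differs from \<open>w i\<close> by such a multiple only. As the \<open>w i\<close> generate
  \<open>b\<close>, a unit multiple of \<open>b\<close> is obtained.\<close>

lemma content_combination:
  fixes a b \<delta> :: "'a :: comm_ring_1"
  assumes e: "\<delta> dvd e * e - e" "(1 - e) * b \<in> ideal.span {a, \<delta>}"
      "\<delta> dvd e * a - c * b" "\<delta> dvd e * c ^ k"
    and J: "ideal.subspace J" and \<delta>: "\<delta> \<in> J"
    and a: "a \<in> ideal.span (insert \<delta> (u ` S))"
    and b: "b \<in> ideal.span (insert \<delta> (w ` S))"
    and u: "\<And>i. i \<in> S \<Longrightarrow> u i \<in> ideal.span {a, \<delta>}"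
    and uw: "\<And>i. i \<in> S \<Longrightarrow> u i + e * w i \<in> J"
  shows "a \<in> J" "b \<in> J"
proof -
  note Jadd = ideal.subspace_add[OF J] and Jdiff = ideal.subspace_diff[OF J]
    and Jmult = ideal.subspace_scale[OF J] and Jcong = subspace_cong[OF J \<delta>]
  have sub: "ideal.subspace {x. r * x \<in> J}" for r
    unfolding ideal.subspace_def
    using ideal.subspace_0[OF J] Jadd Jmult by (auto simp: distrib_left mult.left_commute)
  have "(1 - e) * u i \<in> J" if i: "i \<in> S" for i
  proof (rule Jcong[OF Jmult[OF uw[OF i], of "1 - e"]])
    have "(1 - e) * (u i + e * w i) - (1 - e) * u i = - w i * (e * e - e)"
      by (simp add: algebra_simps)
    then show "\<delta> dvd (1 - e) * (u i + e * w i) - (1 - e) * u i"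
      using e(1) by (metis dvd_mult)
  qed
  then have "ideal.span (insert \<delta> (u ` S)) \<subseteq> {x. (1 - e) * x \<in> J}"
    using Jmult[OF \<delta>] by (intro ideal.span_minimal sub) auto
  with a have a1: "(1 - e) * a \<in> J" by blast
  have b1: "(1 - e) * b \<in> J"
  proof -
    obtain p q where pq: "(1 - e) * b = p * a + q * \<delta>"
      using e(2) unfolding ideal_span_pair by blast
    have "p * ((1 - e) * a) + (1 - e) * q * \<delta> \<in> J"
      by (intro Jadd Jmult a1 \<delta>)
    moreover have "p * ((1 - e) * a) + (1 - e) * q * \<delta> - (1 - e) * b = b * (e * e - e)"
    proof -
      have "p * ((1 - e) * a) + (1 - e) * q * \<delta> = (1 - e) * ((1 - e) * b)"
        unfolding pq by (simp add: algebra_simps)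
      then show ?thesis by (simp add: algebra_simps)
    qed
    ultimately show ?thesis using e(1) by (metis Jcong dvd_mult)
  qed
  \<comment> \<open>The elements that, on the part of \<open>e\<close>, lie in \<open>J\<close> up
    to a multiple of \<open>c * b\<close>. They form an ideal containing \<delta> and every
    \<open>w i\<close>, hence \<open>b\<close>, which puts \<open>e * (1 + r * c) * b\<close> into
    \<open>J\<close>.\<close>
  let ?K = "{x. \<exists>r. e * x + r * c * (e * b) \<in> J}"
  have K: "ideal.subspace ?K"
  proof -
    have "\<exists>r. e * (x + y) + r * c * (e * b) \<in> J"
      if "e * x + r1 * c * (e * b) \<in> J" "e * y + r2 * c * (e * b) \<in> J" for x y r1 r2
      using Jadd[OF that] by (intro exI[of _ "r1 + r2"]) (simp add: algebra_simps)
    moreover have "\<exists>r. e * (p * x) + r * c * (e * b) \<in> J"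
      if "e * x + r1 * c * (e * b) \<in> J" for x p r1
      using Jmult[OF that, of p] by (intro exI[of _ "p * r1"]) (simp add: algebra_simps)
    moreover have "\<exists>r. e * 0 + r * c * (e * b) \<in> J"
      using ideal.subspace_0[OF J] by (intro exI[of _ 0]) simp
    ultimately show ?thesis unfolding ideal.subspace_def by blast
  qed
  have "w i \<in> ?K" if i: "i \<in> S" for i
  proof -
    obtain p q where pq: "u i = p * a + q * \<delta>"
      using u[OF i] unfolding ideal_span_pair by blast
    obtain z1 z2 where z: "e * e - e = \<delta> * z1" "e * a - c * b = \<delta> * z2"
      using e by (auto simp: dvd_def)
    have "e * (u i + e * w i) - (e * w i + p * c * (e * b)) =
        (e * e - e) * (w i - p * a) + p * e * (e * a - c * b) + e * q * \<delta>"
      unfolding pq by (simp add: algebra_simps)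
    also have "\<dots> = \<delta> * (z1 * (w i - p * a) + p * e * z2 + e * q)"
      unfolding z by (simp add: algebra_simps)
    finally have "e * w i + p * c * (e * b) \<in> J"
      using Jcong[OF Jmult[OF uw[OF i], of e]] by auto
    then show ?thesis by blast
  qed
  moreover have "\<delta> \<in> ?K"
    using Jmult[OF \<delta>] by (auto intro: exI[of _ 0])
  ultimately have "b \<in> ?K"
    using ideal.span_minimal[OF _ K, of "insert \<delta> (w ` S)"] b by blast
  then obtain r where r: "e * b + r * c * (e * b) \<in> J" by blast
  have eb: "e * b \<in> J"
  proof -
    \<comment> \<open>\<open>1 + r * c\<close> is a unit on the part of \<open>e\<close>: its
      inverse \<open>q\<close> is a geometric series that stops because \<open>c\<close> is
      nilpotent there.\<close>
    obtain q where q: "1 - (- r * c) ^ k = (1 - (- r * c)) * q"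
      by (metis one_diff_power_eq)
    have "q * (e * b + r * c * (e * b)) = (1 - (- r * c)) * q * (e * b)"
      by (simp add: algebra_simps)
    also have "\<dots> = e * b - (- r) ^ k * b * (e * c ^ k)"
      unfolding q[symmetric] power_mult_distrib by (simp add: algebra_simps)
    finally have "q * (e * b + r * c * (e * b)) - e * b = - ((- r) ^ k * b) * (e * c ^ k)"
      by simp
    then show ?thesis using e(4) Jcong[OF Jmult[OF r, of q]] by (metis dvd_mult)
  qed
  show "b \<in> J" using Jadd[OF b1 eb] by (simp add: left_diff_distrib)
  have "e * a \<in> J"
  proof (rule Jcong[OF Jmult[OF eb, of c]])
    have "c * (e * b) - e * a = a * (e * e - e) - e * (e * a - c * b)"
      by (simp add: algebra_simps)
    then show "\<delta> dvd c * (e * b) - e * a"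
      using e(1,3) by simp
  qed
  with a1 have "(1 - e) * a + e * a \<in> J" by (rule Jadd)
  then show "a \<in> J" by (simp add: left_diff_distrib)
qed

text \<open>The coefficient is the idempotent that marks where \<open>a\<close> is a nilpotent
  multiple of \<open>b\<close>, that is, where \<open>w\<close> has to be added. It is fixed by
  \<open>a\<close> and \<open>b\<close> before the vectors are given, so one statement covers the
  pair \<open>a\<close>, \<open>b\<close> itself and vectors whose contents they generate.\<close>

lemma exists_stable_combination:
  fixes a b \<delta> :: "'a :: comm_ring_1"
  assumes zd: "zero_dimensional_quotient (ideal.span {\<delta>})"
    and ar: "\<exists>s u v. s * a = u * b \<and> (1 - s) * b = v * a"
  shows "\<exists>t. \<forall>S u w. a \<in> ideal.span (insert \<delta> (u ` S)) \<longrightarrow> b \<in> ideal.span (insert \<delta> (w ` S)) \<longrightarrow>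
    u ` S \<subseteq> ideal.span {a, \<delta>} \<longrightarrow>
    {a, b} \<subseteq> ideal.span (insert \<delta> ((\<lambda>i. u i + t * w i) ` (S :: nat set)))"
proof -
  obtain s u v where suv: "s * a = u * b" "(1 - s) * b = v * a" using ar by blast
  obtain e c k where e: "\<delta> dvd e * e - e" "(1 - e) * b \<in> ideal.span {a, \<delta>}"
      "\<delta> dvd e * a - c * b" "\<delta> dvd e * c ^ k"
    using arithmetical_split[OF zd suv] by blast
  show ?thesis
  proof (intro exI[of _ e] allI impI)
    fix S :: "nat set" and u w
    assume *: "a \<in> ideal.span (insert \<delta> (u ` S))" "b \<in> ideal.span (insert \<delta> (w ` S))"
      "u ` S \<subseteq> ideal.span {a, \<delta>}"
    let ?J = "ideal.span (insert \<delta> ((\<lambda>i. u i + e * w i) ` S))"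
    have "a \<in> ?J \<and> b \<in> ?J"
      using content_combination[OF e ideal.subspace_span _ *(1,2), of "insert \<delta> ((\<lambda>i. u i + e * w i) ` S)"] *(3)
      by (simp add: ideal.span_base image_subset_iff)
    then show "{a, b} \<subseteq> ?J" by simp
  qed
qed

section \<open>Stable range modulo \<delta> for families, vectors and matrices\<close>

context
  fixes \<delta> :: "'a :: comm_ring_1"
  assumes zd: "zero_dimensional_quotient (ideal.span {\<delta>})"
    and ar: "\<And>a b :: 'a. \<exists>s u v. s * a = u * b \<and> (1 - s) * b = v * a"
begin

text \<open>The coefficient 1 at \<open>f r\<close> is the point: it allows the generator to be
  produced by a row transvection. The elements are absorbed one by one, each with the coefficient
  that belongs to the current sum and the new element.\<close>

lemma stable_range_principal:
  assumes "finite T" "r \<notin> T"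
  shows "\<exists>t. \<forall>i\<in>insert (r :: nat) T. f i \<in> ideal.span {f r + (\<Sum>j\<in>T. t j * f j), \<delta>}"
  using assms
proof (induction T rule: finite_induct)
  case empty
  have "f r \<in> ideal.span {f r, \<delta>}" by (rule ideal.span_base) simp
  then show ?case by simp
next
  case (insert j T)
  then obtain t where t: "\<forall>i\<in>insert r T. f i \<in> ideal.span {f r + (\<Sum>j\<in>T. t j * f j), \<delta>}"
    by auto
  let ?a = "f r + (\<Sum>j\<in>T. t j * f j)"
  obtain e where "\<forall>S u w. ?a \<in> ideal.span (insert \<delta> (u ` S)) \<longrightarrow> f j \<in> ideal.span (insert \<delta> (w ` S)) \<longrightarrow>
    u ` S \<subseteq> ideal.span {?a, \<delta>} \<longrightarrow>
    {?a, f j} \<subseteq> ideal.span (insert \<delta> ((\<lambda>i. u i + e * w i) ` (S :: nat set)))"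
    using exists_stable_combination[OF zd ar] by blast
  \<comment> \<open>With a one-element index set the statement about vectors becomes one about the
    two elements \<open>?a\<close> and \<open>f j\<close>.\<close>
  from this[rule_format, where S = "{0}" and u = "\<lambda>_. ?a" and w = "\<lambda>_. f j"]
  have e: "?a \<in> ideal.span {?a + e * f j, \<delta>}" "f j \<in> ideal.span {?a + e * f j, \<delta>}"
    by (auto simp: ideal.span_base insert_commute)
  let ?t = "t(j := e)"
  have eq: "f r + (\<Sum>l\<in>insert j T. ?t l * f l) = ?a + e * f j"
  proof -
    have "(\<Sum>l\<in>T. ?t l * f l) = (\<Sum>l\<in>T. t l * f l)"
      using insert.hyps by (intro sum.cong) auto
    then show ?thesis using insert.hyps by (simp add: ac_simps)
  qed
  have "ideal.span {?a, \<delta>} \<subseteq> ideal.span {?a + e * f j, \<delta>}"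
    using e by (intro ideal.span_minimal ideal.subspace_span) (auto intro: ideal.span_base)
  with t e show ?case
    by (intro exI[of _ ?t] ballI, unfold eq) auto
qed

text \<open>Modulo \<delta> each vector has a principal content, generated by some \<open>a\<close>
  for \<open>u\<close> and some \<open>b\<close> for \<open>w\<close>; the coefficient belonging to
  the pair \<open>a\<close>, \<open>b\<close> works for all coordinates simultaneously.\<close>

lemma stable_range_vectors:
  assumes "finite S"
  shows "\<exists>t. \<forall>i\<in>S. {u i, w i} \<subseteq> ideal.span (insert \<delta> ((\<lambda>i. u i + t * w i) ` (S :: nat set)))"
proof (cases "S = {}")
  case False
  then obtain r where r: "r \<in> S" by blast
  then have S: "insert r (S - {r}) = S" by blast
  have *: "\<exists>a. a \<in> ideal.span (insert \<delta> (f ` S)) \<and> f ` S \<subseteq> ideal.span {a, \<delta>}" for f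
  proof -
    obtain t where t: "\<forall>i\<in>S. f i \<in> ideal.span {f r + (\<Sum>j\<in>S-{r}. t j * f j), \<delta>}"
      using stable_range_principal[of "S - {r}" r f] assms S by auto
    have "f r + (\<Sum>j\<in>S-{r}. t j * f j) \<in> ideal.span (insert \<delta> (f ` S))"
      using r by (intro ideal.span_add ideal.span_sum ideal.span_scale) (auto intro: ideal.span_base)
    with t show ?thesis by blast
  qed
  obtain a where a: "a \<in> ideal.span (insert \<delta> (u ` S))" "u ` S \<subseteq> ideal.span {a, \<delta>}"
    using * by blast
  obtain b where b: "b \<in> ideal.span (insert \<delta> (w ` S))" "w ` S \<subseteq> ideal.span {b, \<delta>}"
    using * by blast
  obtain t where t: "{a, b} \<subseteq> ideal.span (insert \<delta> ((\<lambda>i. u i + t * w i) ` S))" (is "_ \<subseteq> ?J")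
    using exists_stable_combination[OF zd ar, of a b] a b(1) by meson
  have "ideal.span {a, \<delta>} \<subseteq> ?J" "ideal.span {b, \<delta>} \<subseteq> ?J"
    using t by (intro ideal.span_minimal ideal.subspace_span; auto intro: ideal.span_base)+
  with a(2) b(2) have "u ` S \<subseteq> ?J" "w ` S \<subseteq> ?J"
    by (meson order_trans)+
  then show ?thesis by (intro exI[of _ t]) (simp add: image_subset_iff)
qed simp

text \<open>The combination of the first \<open>g\<close> columns already carries their whole
  content, so the next column costs one coefficient and the old coefficients stay.\<close>

lemma column_combination_content:
  assumes "finite S"
  shows "\<exists>x. \<forall>i\<in>S. \<forall>j<g::nat. A i j \<in> ideal.span (insert \<delta> ((\<lambda>i. \<Sum>j<g. x j * A i j) ` (S :: nat set)))"
proof (induction g)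
  case (Suc g)
  then obtain x where x: "\<forall>i\<in>S. \<forall>j<g. A i j \<in> ideal.span (insert \<delta> ((\<lambda>i. \<Sum>j<g. x j * A i j) ` S))"
    by blast
  obtain t where t: "\<forall>i\<in>S. {\<Sum>j<g. x j * A i j, A i g} \<subseteq>
      ideal.span (insert \<delta> ((\<lambda>i. (\<Sum>j<g. x j * A i j) + t * A i g) ` S))"
    using stable_range_vectors[OF assms, of "\<lambda>i. \<Sum>j<g. x j * A i j" "\<lambda>i. A i g"] by (elim exE)
  let ?x = "x(g := t)"
  have eq: "(\<Sum>j<Suc g. ?x j * A i j) = (\<Sum>j<g. x j * A i j) + t * A i g" for i
  proof -
    have "(\<Sum>j<g. ?x j * A i j) = (\<Sum>j<g. x j * A i j)" by (rule sum.cong) auto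
    then show ?thesis by simp
  qed
  let ?J = "ideal.span (insert \<delta> ((\<lambda>i. \<Sum>j<Suc g. ?x j * A i j) ` S))"
  have "ideal.span (insert \<delta> ((\<lambda>i. \<Sum>j<g. x j * A i j) ` S)) \<subseteq> ?J"
    unfolding eq using t
    by (intro ideal.span_minimal ideal.subspace_span) (simp add: ideal.span_base image_subset_iff)
  with x have "A i j \<in> ?J" if "i \<in> S" "j < g" for i j
    using that by blast
  moreover have "A i g \<in> ?J" if "i \<in> S" for i
    using t that unfolding eq by simp
  ultimately have "\<forall>i\<in>S. \<forall>j<Suc g. A i j \<in> ?J"
    by (simp add: less_Suc_eq)
  then show ?case by blast
qed simp

end

subsection \<open>Diagonalizing the image of a matrix by row operations\<close>

definition col_span :: "'a :: comm_ring_1 mat \<Rightarrow> 'a vec set" where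
  "col_span A = (\<lambda>x. A *\<^sub>v x) ` carrier_vec (dim_col A)"

lemma col_span_carrier: "A \<in> carrier_mat n m \<Longrightarrow> w \<in> col_span A \<Longrightarrow> w \<in> carrier_vec n"
  unfolding col_span_def by (auto simp: mult_mat_vec_carrier)

lemma mult_mat_vec_smult:
  assumes "A \<in> carrier_mat n m" "v \<in> carrier_vec m"
  shows "A *\<^sub>v (c \<cdot>\<^sub>v v) = c \<cdot>\<^sub>v (A *\<^sub>v (v :: 'a :: comm_ring_1 vec))"
  using assms by (intro eq_vecI) auto

lemma col_span_add:
  assumes "A \<in> carrier_mat n m" "v \<in> col_span A" "w \<in> col_span A"
  shows "v + w \<in> col_span A"
  using assms mult_add_distrib_mat_vec[of A n m] unfolding col_span_def
  by (smt (verit, best) add_carrier_vec carrier_matD(2) imageE imageI)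

lemma col_span_smult:
  assumes "A \<in> carrier_mat n m" "v \<in> col_span A"
  shows "c \<cdot>\<^sub>v v \<in> col_span A"
  using assms mult_mat_vec_smult[of A n m] unfolding col_span_def
  by (smt (verit, best) smult_carrier_vec carrier_matD(2) imageE imageI)

lemma col_span_mult:
  assumes "L \<in> carrier_mat k n" "A \<in> carrier_mat n m"
  shows "col_span (L * A) = (\<lambda>w. L *\<^sub>v w) ` col_span A"
  using assms unfolding col_span_def image_image
  by (intro image_cong) auto

text \<open>\<open>L\<close> is onto and commutes with scalars, so the multiples of \<delta> remain
  in the image after a change of rows.\<close>

lemma smult_in_col_span_mult:
  assumes L: "L \<in> carrier_mat n n" "L' \<in> carrier_mat n n" "L * L' = 1\<^sub>m n"
    and A: "A \<in> carrier_mat n m" and \<delta>: "\<And>v. v \<in> carrier_vec n \<Longrightarrow> \<delta> \<cdot>\<^sub>v v \<in> col_span A"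
    and v: "v \<in> carrier_vec n"
  shows "\<delta> \<cdot>\<^sub>v v \<in> col_span (L * A)"
proof -
  have "L *\<^sub>v (L' *\<^sub>v v) = v"
    using L v by (subst assoc_mult_mat_vec[symmetric]) auto
  then have "L *\<^sub>v (\<delta> \<cdot>\<^sub>v (L' *\<^sub>v v)) = \<delta> \<cdot>\<^sub>v v"
    using L v mult_mat_vec_smult[OF L(1)] by auto
  moreover have "\<delta> \<cdot>\<^sub>v (L' *\<^sub>v v) \<in> col_span A" using L v by (intro \<delta>) auto
  ultimately show ?thesis unfolding col_span_mult[OF L(1) A] by (metis imageI)
qed

lemma mult_mat_right_inverse:
  fixes P :: "'a :: semiring_1 mat"
  assumes "P \<in> carrier_mat n n" "Q \<in> carrier_mat n n" "P' \<in> carrier_mat n n" "Q' \<in> carrier_mat n n"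
    and "P * P' = 1\<^sub>m n" "Q * Q' = 1\<^sub>m n"
  shows "P * Q * (Q' * P') = 1\<^sub>m n"
proof -
  have "P * Q * (Q' * P') = P * (Q * (Q' * P'))" using assms by (intro assoc_mult_mat) auto
  also have "Q * (Q' * P') = (Q * Q') * P'" using assms by (intro assoc_mult_mat[symmetric]) auto
  finally show ?thesis using assms by simp
qed

text \<open>A rank-one update of the identity: one such matrix performs a whole batch of elementary
  row operations. When \<open>q\<close> annihilates \<open>p\<close>, the rank-one part squares to
  zero, and changing the sign of \<open>p\<close> gives the inverse.\<close>

definition transvection :: "nat \<Rightarrow> (nat \<Rightarrow> 'a) \<Rightarrow> (nat \<Rightarrow> 'a) \<Rightarrow> 'a :: comm_ring_1 mat" where
  "transvection n p q = mat n n (\<lambda>(i, j). (if i = j then 1 else 0) + p i * q j)"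

lemma transvection_carrier [simp]: "transvection n p q \<in> carrier_mat n n"
  unfolding transvection_def by simp

lemma transvection_mult_vec:
  assumes "w \<in> carrier_vec n" "i < n"
  shows "(transvection n p q *\<^sub>v w) $ i = w $ i + p i * (\<Sum>j<n. q j * w $ j)"
proof -
  have "(transvection n p q *\<^sub>v w) $ i = (\<Sum>j<n. ((if i = j then 1 else 0) + p i * q j) * w $ j)"
    using assms unfolding transvection_def
    by (simp add: scalar_prod_def atLeast0LessThan)
  also have "\<dots> = (\<Sum>j<n. (if i = j then w $ j else 0) + p i * (q j * w $ j))"
    by (intro sum.cong) (auto simp: algebra_simps)
  finally show ?thesis using assms(2) by (simp add: sum.distrib sum_distrib_left)
qed

lemma transvection_inverse:
  assumes "(\<Sum>j<n. q j * p j) = 0"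
  shows "transvection n p q * transvection n (\<lambda>i. - p i) q = 1\<^sub>m n"
proof (rule eq_matI)
  fix i j assume "i < dim_row (1\<^sub>m n :: 'a mat)" "j < dim_col (1\<^sub>m n :: 'a mat)"
  then have ij: "i < n" "j < n" by auto
  let ?w = "col (transvection n (\<lambda>i. - p i) q) j"
  have "(transvection n p q * transvection n (\<lambda>i. - p i) q) $$ (i, j) = (transvection n p q *\<^sub>v ?w) $ i"
    using ij by (simp add: transvection_def)
  also have "\<dots> = ?w $ i + p i * (\<Sum>l<n. q l * ?w $ l)"
    by (rule transvection_mult_vec) (use ij in \<open>simp_all add: transvection_def carrier_vecI\<close>)
  also have "(\<Sum>l<n. q l * ?w $ l) = (\<Sum>l<n. (if l = j then q l else 0) - q j * (q l * p l))"
    using ij by (intro sum.cong) (auto simp: transvection_def algebra_simps)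
  also have "\<dots> = q j"
    using ij assms by (simp add: sum_subtractf sum_distrib_left[symmetric])
  also have "?w $ i + p i * q j = (1\<^sub>m n) $$ (i, j)"
    using ij by (simp add: transvection_def)
  finally show "(transvection n p q * transvection n (\<lambda>i. - p i) q) $$ (i, j) = (1\<^sub>m n) $$ (i, j)" .
qed (auto simp: transvection_def)

lemma transvection_invertible:
  assumes "(\<Sum>j<n. q j * p j) = 0"
  shows "\<exists>T' \<in> carrier_mat n n. transvection n p q * T' = 1\<^sub>m n \<and> T' * transvection n p q = 1\<^sub>m n"
proof (intro bexI conjI)
  show "transvection n p q * transvection n (\<lambda>i. - p i) q = 1\<^sub>m n"
    by (rule transvection_inverse[OF assms])
  show "transvection n (\<lambda>i. - p i) q * transvection n p q = 1\<^sub>m n"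
    using transvection_inverse[of q "\<lambda>i. - p i" n] assms by (simp add: sum_negf)
qed simp

text \<open>The part of \<open>N\<close> in the first \<open>r\<close> coordinates is split off as a sum of ideals \<open>\<langle>a k, \<delta>\<rangle>\<close>.\<close>

definition diagonal_upto :: "nat \<Rightarrow> 'a :: comm_ring_1 \<Rightarrow> nat \<Rightarrow> 'a vec set \<Rightarrow> (nat \<Rightarrow> 'a) \<Rightarrow> bool" where
  "diagonal_upto n \<delta> r N a \<longleftrightarrow>
     (\<forall>k < r. a k \<cdot>\<^sub>v unit_vec n k \<in> N) \<and>
     (\<forall>w \<in> N. \<forall>k < r. \<forall>i < n. k \<le> i \<longrightarrow> w $ i \<in> ideal.span {a k, \<delta>})"

text \<open>Both \<open>a s\<close> and \<delta> times the \<open>s\<close>-th unit vector lie in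
  the image, and they generate the ideal of the coordinate \<open>w $ s\<close>, so this coordinate
  can be subtracted without leaving the image. Hence the next pivot vector may be taken to vanish in
  the finished coordinates.\<close>

lemma col_span_truncate:
  assumes A: "A \<in> carrier_mat n m" and \<delta>: "\<And>v. v \<in> carrier_vec n \<Longrightarrow> \<delta> \<cdot>\<^sub>v v \<in> col_span A"
    and diag: "diagonal_upto n \<delta> r (col_span A) a" and w: "w \<in> col_span A" and "r \<le> n" "s \<le> r"
  shows "vec n (\<lambda>i. if i < s then 0 else w $ i) \<in> col_span A"
  using \<open>s \<le> r\<close>
proof (induction s)
  case 0
  have "vec n (\<lambda>i. w $ i) = w" using col_span_carrier[OF A w] by (intro eq_vecI) auto
  with w show ?case by simp
next
  case (Suc s)
  let ?u = "vec n (\<lambda>i. if i < s then 0 else w $ i)"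
  have u: "?u \<in> col_span A" using Suc by simp
  have "w $ s \<in> ideal.span {a s, \<delta>}"
    using diag w Suc.prems \<open>r \<le> n\<close> unfolding diagonal_upto_def by simp
  then obtain p q where pq: "w $ s = p * a s + q * \<delta>" unfolding ideal_span_pair by blast
  have "a s \<cdot>\<^sub>v unit_vec n s \<in> col_span A"
    using diag Suc.prems unfolding diagonal_upto_def by simp
  then have "?u + (- p) \<cdot>\<^sub>v (a s \<cdot>\<^sub>v unit_vec n s) + \<delta> \<cdot>\<^sub>v ((- q) \<cdot>\<^sub>v unit_vec n s) \<in> col_span A"
    by (intro col_span_add[OF A] col_span_smult[OF A, of _ "- p"] u \<delta>) auto
  also have "?u + (- p) \<cdot>\<^sub>v (a s \<cdot>\<^sub>v unit_vec n s) + \<delta> \<cdot>\<^sub>v ((- q) \<cdot>\<^sub>v unit_vec n s) =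
      vec n (\<lambda>i. if i < Suc s then 0 else w $ i)"
    using pq by (intro eq_vecI) (auto simp: less_Suc_eq algebra_simps unit_vec_def)
  finally show ?case .
qed

text \<open>The pivot vector \<open>v\<close> lies in the image, vanishes before row
  \<open>r\<close>, and its content modulo \<delta> contains all entries of \<open>A\<close> from
  row \<open>r\<close> on. \<open>L1\<close> adds multiples of the later rows to row
  \<open>r\<close>, so that this row holds the generator \<alpha> of the content; \<open>L2\<close>
  subtracts multiples of row \<open>r\<close> from the later rows and leaves only multiples of
  \<delta> there.\<close>

lemma diagonal_upto_step:
  fixes \<delta> :: "'a :: comm_ring_1"
  assumes zd: "zero_dimensional_quotient (ideal.span {\<delta>})"
    and ar: "\<And>a b :: 'a. \<exists>s u v. s * a = u * b \<and> (1 - s) * b = v * a"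
    and A: "A \<in> carrier_mat n m" and \<delta>: "\<And>v. v \<in> carrier_vec n \<Longrightarrow> \<delta> \<cdot>\<^sub>v v \<in> col_span A"
    and diag: "diagonal_upto n \<delta> r (col_span A) a" and r: "r < n"
  shows "\<exists>L \<in> carrier_mat n n. \<exists>L' \<in> carrier_mat n n. \<exists>\<alpha>. L * L' = 1\<^sub>m n \<and> L' * L = 1\<^sub>m n \<and>
    diagonal_upto n \<delta> (Suc r) (col_span (L * A)) (a(r := \<alpha>))"
proof -
  define T where "T = {r<..<n}"
  have S: "insert r T = {r..<n}" and T: "finite T" "r \<notin> T" using r by (auto simp: T_def)
  obtain x where x: "\<forall>i\<in>{r..<n}. \<forall>j<m. A $$ (i, j) \<in>
      ideal.span (insert \<delta> ((\<lambda>i. \<Sum>j<m. x j * A $$ (i, j)) ` {r..<n}))"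
    using column_combination_content[OF zd ar, of "{r..<n}" m "\<lambda>i j. A $$ (i, j)"] by auto
  define v0 where "v0 = A *\<^sub>v vec m x"
  have v0: "v0 $ i = (\<Sum>j<m. x j * A $$ (i, j))" if "i < n" for i
    using that A unfolding v0_def by (auto simp: scalar_prod_def atLeast0LessThan mult.commute)
  define v where "v = vec n (\<lambda>i. if i < r then 0 else v0 $ i)"
  have v: "v \<in> col_span A"
    unfolding v_def using A r
    by (intro col_span_truncate[OF A \<delta> diag]) (auto simp: col_span_def v0_def)
  have vc: "v \<in> carrier_vec n" by (simp add: v_def)
  obtain t where t: "\<forall>i\<in>{r..<n}. v $ i \<in> ideal.span {v $ r + (\<Sum>j\<in>T. t j * v $ j), \<delta>}"
    using stable_range_principal[OF zd ar T, of "\<lambda>i. v $ i"] unfolding S by auto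
  define \<tau> where "\<tau> w = w $ r + (\<Sum>j\<in>T. t j * w $ j)" for w
  define \<alpha> where "\<alpha> = \<tau> v"
  have "\<forall>i\<in>{r..<n}. \<exists>d z. v $ i = d * \<alpha> + z * \<delta>"
    using t unfolding ideal_span_pair \<alpha>_def \<tau>_def .
  then obtain d z where dz: "\<And>i. i \<in> {r..<n} \<Longrightarrow> v $ i = d i * \<alpha> + z i * \<delta>"
    by metis
  define L1 where "L1 = transvection n (\<lambda>i. if i = r then 1 else 0) (\<lambda>j. if j \<in> T then t j else 0)"
  define L2 where "L2 = transvection n (\<lambda>i. if i \<in> T then - d i else 0) (\<lambda>j. if j = r then 1 else 0)"
  have Lc: "L1 \<in> carrier_mat n n" "L2 \<in> carrier_mat n n" by (auto simp: L1_def L2_def)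
  have "(\<Sum>j<n. (if j \<in> T then t j else 0) * (if j = r then 1 else 0)) = 0"
    using T by (intro sum.neutral) auto
  from transvection_invertible[OF this] obtain L1' where L1': "L1' \<in> carrier_mat n n" "L1 * L1' = 1\<^sub>m n" "L1' * L1 = 1\<^sub>m n"
    unfolding L1_def by blast
  have "(\<Sum>j<n. (if j = r then 1 else 0) * (if j \<in> T then - d j else 0)) = 0"
    using T by (intro sum.neutral) auto
  from transvection_invertible[OF this] obtain L2' where L2': "L2' \<in> carrier_mat n n" "L2 * L2' = 1\<^sub>m n" "L2' * L2 = 1\<^sub>m n"
    unfolding L2_def by blast
  define L where "L = L2 * L1"
  define L' where "L' = L1' * L2'"
  have LLc: "L \<in> carrier_mat n n" "L' \<in> carrier_mat n n"
    using Lc L1' L2' by (auto simp: L_def L'_def)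
  have LL: "L * L' = 1\<^sub>m n" "L' * L = 1\<^sub>m n"
    unfolding L_def L'_def by (intro mult_mat_right_inverse Lc L1' L2')+
  have L1w: "(L1 *\<^sub>v w) $ i = (if i = r then \<tau> w else w $ i)" if w: "w \<in> carrier_vec n" "i < n" for w i
  proof -
    have "(\<Sum>j<n. (if j \<in> T then t j else 0) * w $ j) = (\<Sum>j\<in>T. t j * w $ j)"
      by (intro sum.mono_neutral_cong_right) (auto simp: T_def)
    then show ?thesis unfolding L1_def transvection_mult_vec[OF w] by (simp add: \<tau>_def)
  qed
  have Lw: "(L *\<^sub>v w) $ i = (if i = r then \<tau> w else if i \<in> T then w $ i - d i * \<tau> w else w $ i)"
    if w: "w \<in> carrier_vec n" "i < n" for w i
  proof -
    have c: "L1 *\<^sub>v w \<in> carrier_vec n" using Lc w by auto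
    have "L *\<^sub>v w = L2 *\<^sub>v (L1 *\<^sub>v w)"
      unfolding L_def using Lc w by auto
    moreover have "(\<Sum>j<n. (if j = r then 1 else 0) * (L1 *\<^sub>v w) $ j) = (\<Sum>j<n. if j = r then (L1 *\<^sub>v w) $ j else 0)"
      by (intro sum.cong) auto
    ultimately have "(L *\<^sub>v w) $ i = (L1 *\<^sub>v w) $ i + (if i \<in> T then - d i else 0) * (L1 *\<^sub>v w) $ r"
      unfolding L2_def using transvection_mult_vec[OF c w(2)] r by simp
    then show ?thesis using L1w[OF w] L1w[OF w(1) r] T by auto
  qed
  \<comment> \<open>Both transvections combine only rows from \<open>r\<close> on. This keeps the
    earlier pivot conditions alive and also yields the new one.\<close>
  have closed: "(L *\<^sub>v w) $ i \<in> I"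
    if w: "w \<in> carrier_vec n" and i: "i \<in> {r..<n}" and I: "ideal.subspace I"
      and wI: "\<And>i. i \<in> {r..<n} \<Longrightarrow> w $ i \<in> I" for w i I
  proof -
    have "\<tau> w \<in> I" unfolding \<tau>_def using wI r
      by (intro ideal.subspace_add[OF I] ideal.subspace_sum[OF I] ideal.subspace_scale[OF I]) (auto simp: T_def)
    then show ?thesis
      using Lw[OF w] i wI[OF i] ideal.subspace_diff[OF I] ideal.subspace_scale[OF I] by auto
  qed
  have LA: "L * A \<in> carrier_mat n m" using LLc A by auto
  have img: "col_span (L * A) = (\<lambda>w. L *\<^sub>v w) ` col_span A" by (rule col_span_mult[OF LLc(1) A])
  have 1: "(a(r := \<alpha>)) k \<cdot>\<^sub>v unit_vec n k \<in> col_span (L * A)" if "k < Suc r" for k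
  proof (cases "k = r")
    case False
    with that have k: "k < r" by simp
    \<comment> \<open>The earlier pivot vectors are supported before row \<open>r\<close>, so
      \<open>L\<close> fixes them.\<close>
    have "\<tau> (a k \<cdot>\<^sub>v unit_vec n k) = 0"
      using k r by (auto simp: \<tau>_def T_def unit_vec_def intro!: sum.neutral)
    then have "L *\<^sub>v (a k \<cdot>\<^sub>v unit_vec n k) = a k \<cdot>\<^sub>v unit_vec n k"
      using Lw[of "a k \<cdot>\<^sub>v unit_vec n k"] LLc k r by (intro eq_vecI) auto
    moreover have "a k \<cdot>\<^sub>v unit_vec n k \<in> col_span A"
      using diag k unfolding diagonal_upto_def by blast
    ultimately have "a k \<cdot>\<^sub>v unit_vec n k \<in> col_span (L * A)"
      unfolding img by (metis imageI)
    then show ?thesis using False by simp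
  next
    case True
    \<comment> \<open>Cancels the rest \<open>z i * \<delta>\<close> that \<open>L2\<close> leaves
      in row \<open>i\<close> of the transformed \<open>v\<close>; this stays in the image because
      multiples of \<delta> do.\<close>
    define y where "y = vec n (\<lambda>i. if i \<in> T then - z i else 0)"
    have "\<delta> \<cdot>\<^sub>v y \<in> col_span (L * A)"
      by (rule smult_in_col_span_mult[OF LLc LL(1) A \<delta>]) (simp_all add: y_def)
    moreover have "L *\<^sub>v v \<in> col_span (L * A)" unfolding img using v by blast
    ultimately have "L *\<^sub>v v + \<delta> \<cdot>\<^sub>v y \<in> col_span (L * A)" by (intro col_span_add[OF LA])
    also have "L *\<^sub>v v + \<delta> \<cdot>\<^sub>v y = \<alpha> \<cdot>\<^sub>v unit_vec n r"
    proof (rule eq_vecI)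
      fix i assume "i < dim_vec (\<alpha> \<cdot>\<^sub>v unit_vec n r)"
      then have i: "i < n" by simp
      consider "i < r" | "i = r" | "i \<in> T" using i by (fastforce simp: T_def)
      then show "(L *\<^sub>v v + \<delta> \<cdot>\<^sub>v y) $ i = (\<alpha> \<cdot>\<^sub>v unit_vec n r) $ i"
      proof cases
        case 3
        then have "i \<noteq> r" "i \<in> {r..<n}" using T S by auto
        with 3 i r dz[of i] show ?thesis
          using Lw[OF vc i] by (simp add: y_def unit_vec_def \<alpha>_def mult.commute)
      qed (use i r T Lw[OF vc i] in \<open>auto simp: y_def T_def \<alpha>_def v_def unit_vec_def\<close>)
    qed (use LLc in \<open>auto simp: y_def\<close>)
    finally show ?thesis using True by simp
  qed
  have 2: "w $ i \<in> ideal.span {(a(r := \<alpha>)) k, \<delta>}"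
    if w: "w \<in> col_span (L * A)" and k: "k < Suc r" and i: "i < n" "k \<le> i" for w k i
  proof -
    obtain w0 where w0: "w0 \<in> col_span A" "w = L *\<^sub>v w0" using w unfolding img by blast
    note w0c = col_span_carrier[OF A w0(1)]
    show ?thesis
    proof (cases "k = r")
      case False
      then have "w0 $ i \<in> ideal.span {a k, \<delta>}" if "i < n" "k \<le> i" for i
        using diag w0 that k unfolding diagonal_upto_def by simp
      then show ?thesis
        using closed[OF w0c, of i "ideal.span {a k, \<delta>}"] Lw[OF w0c i(1)] False i k w0(2)
        by (cases "i < r") (auto simp: T_def)
    next
      case True
      \<comment> \<open>By the choice of \<open>x\<close>, the ideal on the left contains all
        entries of \<open>A\<close> from row \<open>r\<close> on, hence all coordinates from
        \<open>r\<close> on of every vector in the image.\<close>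
      have J: "ideal.span (insert \<delta> ((\<lambda>i. \<Sum>j<m. x j * A $$ (i, j)) ` {r..<n})) \<subseteq> ideal.span {\<alpha>, \<delta>}"
      proof (intro ideal.span_minimal ideal.subspace_span)
        have "(\<Sum>j<m. x j * A $$ (i, j)) \<in> ideal.span {\<alpha>, \<delta>}" if "i \<in> {r..<n}" for i
        proof -
          have "(\<Sum>j<m. x j * A $$ (i, j)) = v $ i" using that by (simp add: v_def v0)
          then show ?thesis using t that by (simp add: \<alpha>_def \<tau>_def)
        qed
        then show "insert \<delta> ((\<lambda>i. \<Sum>j<m. x j * A $$ (i, j)) ` {r..<n}) \<subseteq> ideal.span {\<alpha>, \<delta>}"
          by (auto intro: ideal.span_base)
      qed
      obtain y where y: "y \<in> carrier_vec m" "w0 = A *\<^sub>v y" using w0(1) A unfolding col_span_def by auto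
      have "w0 $ i \<in> ideal.span {\<alpha>, \<delta>}" if i: "i \<in> {r..<n}" for i
      proof -
        have "w0 $ i = (\<Sum>j<m. y $ j * A $$ (i, j))"
          using i A y by (auto simp: scalar_prod_def atLeast0LessThan mult.commute)
        also have "\<dots> \<in> ideal.span {\<alpha>, \<delta>}"
          using x J i by (intro ideal.span_sum ideal.span_scale) blast
        finally show ?thesis .
      qed
      then show ?thesis using closed[OF w0c, of i "ideal.span {\<alpha>, \<delta>}"] True i w0(2) by auto
    qed
  qed
  show ?thesis
    using LLc LL 1 2 unfolding diagonal_upto_def by blast
qed

text \<open>After \<open>n\<close> steps the pivot vectors and the multiples of \<delta> span the
  sum of the ideals, and the membership condition at \<open>k = i\<close> bounds the image by that
  sum. The chain condition is the membership condition applied to the pivot vectors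
  themselves.\<close>

theorem exists_diagonal_image:
  fixes \<delta> :: "'a :: comm_ring_1"
  assumes zd: "zero_dimensional_quotient (ideal.span {\<delta>})"
    and ar: "\<And>a b :: 'a. \<exists>s u v. s * a = u * b \<and> (1 - s) * b = v * a"
    and A: "A \<in> carrier_mat n m" and \<delta>: "\<And>v. v \<in> carrier_vec n \<Longrightarrow> \<delta> \<cdot>\<^sub>v v \<in> col_span A"
  shows "\<exists>L \<in> carrier_mat n n. \<exists>L' \<in> carrier_mat n n. \<exists>a. L * L' = 1\<^sub>m n \<and> L' * L = 1\<^sub>m n \<and>
    col_span (L * A) = {w \<in> carrier_vec n. \<forall>i<n. w $ i \<in> ideal.span {a i, \<delta>}} \<and>
    (\<forall>i. Suc i < n \<longrightarrow> a (Suc i) \<in> ideal.span {a i, \<delta>})"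
proof -
  have "\<exists>L \<in> carrier_mat n n. \<exists>L' \<in> carrier_mat n n. \<exists>a. L * L' = 1\<^sub>m n \<and> L' * L = 1\<^sub>m n \<and>
    diagonal_upto n \<delta> r (col_span (L * A)) a" if "r \<le> n" for r
    using that
  proof (induction r)
    case 0
    show ?case by (intro bexI[of _ "1\<^sub>m n"]) (auto simp: diagonal_upto_def)
  next
    case (Suc r)
    then obtain L L' a where L: "L \<in> carrier_mat n n" "L' \<in> carrier_mat n n" "L * L' = 1\<^sub>m n" "L' * L = 1\<^sub>m n"
      "diagonal_upto n \<delta> r (col_span (L * A)) a" by auto
    have LA: "L * A \<in> carrier_mat n m" using L A by auto
    have \<delta>': "\<delta> \<cdot>\<^sub>v v \<in> col_span (L * A)" if v: "v \<in> carrier_vec n" for v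
      by (rule smult_in_col_span_mult[OF L(1-3) A \<delta> v])
    obtain K K' \<alpha> where K: "K \<in> carrier_mat n n" "K' \<in> carrier_mat n n" "K * K' = 1\<^sub>m n" "K' * K = 1\<^sub>m n"
      "diagonal_upto n \<delta> (Suc r) (col_span (K * (L * A))) (a(r := \<alpha>))"
      using diagonal_upto_step[OF zd ar LA \<delta>' L(5)] Suc.prems by auto
    have assoc: "K * (L * A) = (K * L) * A" using K L A by (intro assoc_mult_mat[symmetric]) auto
    have 1: "K * L * (L' * K') = 1\<^sub>m n" and 2: "L' * K' * (K * L) = 1\<^sub>m n"
      using K L by (auto intro!: mult_mat_right_inverse)
    have "K * L \<in> carrier_mat n n" "L' * K' \<in> carrier_mat n n" using K L by auto
    with 1 2 K(5) show ?case unfolding assoc by blast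
  qed
  from this[of n] obtain L L' a where L: "L \<in> carrier_mat n n" "L' \<in> carrier_mat n n" "L * L' = 1\<^sub>m n" "L' * L = 1\<^sub>m n"
    "diagonal_upto n \<delta> n (col_span (L * A)) a" by auto
  have LA: "L * A \<in> carrier_mat n m" using L A by auto
  have unit: "a k \<cdot>\<^sub>v unit_vec n k \<in> col_span (L * A)" if "k < n" for k
    using L(5) that unfolding diagonal_upto_def by blast
  have mem: "w $ i \<in> ideal.span {a k, \<delta>}" if "w \<in> col_span (L * A)" "k \<le> i" "i < n" for w k i
    using L(5) that unfolding diagonal_upto_def by simp
  have \<delta>': "\<delta> \<cdot>\<^sub>v v \<in> col_span (L * A)" if v: "v \<in> carrier_vec n" for v
    by (rule smult_in_col_span_mult[OF L(1-3) A \<delta> v])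
  have "col_span (L * A) = {w \<in> carrier_vec n. \<forall>i<n. w $ i \<in> ideal.span {a i, \<delta>}}"
  proof (intro equalityI subsetI CollectI conjI allI impI)
    fix w assume w: "w \<in> {w \<in> carrier_vec n. \<forall>i<n. w $ i \<in> ideal.span {a i, \<delta>}}"
    have "vec n (\<lambda>i. if i < k then w $ i else 0) \<in> col_span (L * A)" if "k \<le> n" for k
      using that
    proof (induction k)
      case 0
      have "vec n (\<lambda>i. if i < 0 then w $ i else 0) = \<delta> \<cdot>\<^sub>v 0\<^sub>v n" by (intro eq_vecI) auto
      with \<delta>' show ?case by simp
    next
      case (Suc k)
      have "w $ k \<in> ideal.span {a k, \<delta>}" using w Suc.prems by simp
      then obtain p q where pq: "w $ k = p * a k + q * \<delta>" unfolding ideal_span_pair by blast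
      have "vec n (\<lambda>i. if i < k then w $ i else 0) + p \<cdot>\<^sub>v (a k \<cdot>\<^sub>v unit_vec n k)
          + \<delta> \<cdot>\<^sub>v (q \<cdot>\<^sub>v unit_vec n k) \<in> col_span (L * A)"
        using Suc unit[of k] by (intro col_span_add[OF LA] col_span_smult[OF LA, of _ p] \<delta>') auto
      also have "vec n (\<lambda>i. if i < k then w $ i else 0) + p \<cdot>\<^sub>v (a k \<cdot>\<^sub>v unit_vec n k)
          + \<delta> \<cdot>\<^sub>v (q \<cdot>\<^sub>v unit_vec n k) = vec n (\<lambda>i. if i < Suc k then w $ i else 0)"
        using pq by (intro eq_vecI) (auto simp: unit_vec_def less_Suc_eq mult.commute)
      finally show ?case .
    qed
    from this[of n] have "vec n (\<lambda>i. if i < n then w $ i else 0) \<in> col_span (L * A)" by simp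
    moreover have "vec n (\<lambda>i. if i < n then w $ i else 0) = w" using w by (intro eq_vecI) auto
    ultimately show "w \<in> col_span (L * A)" by simp
  qed (use mem col_span_carrier[OF LA] in auto)
  moreover have "a (Suc i) \<in> ideal.span {a i, \<delta>}" if "Suc i < n" for i
    using mem[OF unit[OF that], of i "Suc i"] that by simp
  ultimately show ?thesis using L by blast
qed

subsection \<open>Invertible ideals of a Pruefer domain\<close>

lemma unit_ideal_eq: "unit_ideal = range to_fract"
  unfolding unit_ideal_def fracmod.span_singleton by simp

lemma one_in_unit_ideal [simp]: "1 \<in> unit_ideal"
  unfolding unit_ideal_eq by (intro image_eqI[of _ _ 1]) auto

lemma subspace_imp_fracmod_mult:
  "fracmod.subspace I \<Longrightarrow> x \<in> I \<Longrightarrow> z \<in> unit_ideal \<Longrightarrow> x * z \<in> I"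
  unfolding unit_ideal_eq using fracmod.subspace_scale by (auto simp: mult.commute)

lemma fracmod_subspace_vimage:
  assumes "fracmod.subspace I"
  shows "fracmod.subspace {x. c * x \<in> I}"
  using assms unfolding fracmod.subspace_def by (auto simp: distrib_left mult.left_commute[of c])

lemma fracmod_subspace_combinations:
  assumes I: "fracmod.subspace I" and J: "fracmod.subspace J"
  shows "fracmod.subspace {w. \<exists>x\<in>I. \<exists>y\<in>J. w = a * x + b * y}" (is "fracmod.subspace ?K")
  unfolding fracmod.subspace_def
proof (intro conjI ballI allI)
  show "0 \<in> ?K" using fracmod.subspace_0[OF I] fracmod.subspace_0[OF J] by force
next
  fix v w assume "v \<in> ?K" "w \<in> ?K"
  then obtain x y x' y' where *: "x \<in> I" "y \<in> J" "v = a * x + b * y"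
    "x' \<in> I" "y' \<in> J" "w = a * x' + b * y'" by blast
  then have "v + w = a * (x + x') + b * (y + y')" by (simp add: algebra_simps)
  moreover have "x + x' \<in> I" "y + y' \<in> J"
    using * by (auto intro: fracmod.subspace_add[OF I] fracmod.subspace_add[OF J])
  ultimately show "v + w \<in> ?K" by blast
next
  fix c w assume "w \<in> ?K"
  then obtain x y where *: "x \<in> I" "y \<in> J" "w = a * x + b * y" by blast
  then have "to_fract c * w = a * (to_fract c * x) + b * (to_fract c * y)"
    by (simp add: algebra_simps)
  moreover have "to_fract c * x \<in> I" "to_fract c * y \<in> J"
    using * by (auto intro: fracmod.subspace_scale[OF I] fracmod.subspace_scale[OF J])
  ultimately show "to_fract c * w \<in> ?K" by blast
qed

lemma to_fract_image_span: "to_fract ` ideal.span S = fracmod.span (to_fract ` S)"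
proof (intro equalityI subsetI)
  fix y assume "y \<in> to_fract ` ideal.span S"
  then obtain x where "x \<in> ideal.span S" "y = to_fract x" by blast
  moreover have "ideal.subspace {x. to_fract x \<in> fracmod.span (to_fract ` S)}"
    unfolding ideal.subspace_def
    using fracmod.span_zero fracmod.span_add fracmod.span_scale by fastforce
  then have "ideal.span S \<subseteq> {x. to_fract x \<in> fracmod.span (to_fract ` S)}"
    by (intro ideal.span_minimal) (auto intro: fracmod.span_base)
  ultimately show "y \<in> fracmod.span (to_fract ` S)" by blast
next
  fix y assume "y \<in> fracmod.span (to_fract ` S)"
  moreover have "fracmod.subspace (to_fract ` ideal.span S)"
    unfolding fracmod.subspace_def
  proof (intro conjI ballI allI)
    show "0 \<in> to_fract ` ideal.span S"
      using ideal.span_zero[of S] by (intro image_eqI[of _ _ 0]) auto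
  next
    fix x y assume "x \<in> to_fract ` ideal.span S" "y \<in> to_fract ` ideal.span S"
    then obtain x' y' where "x' \<in> ideal.span S" "y' \<in> ideal.span S" "x = to_fract x'" "y = to_fract y'"
      by blast
    then show "x + y \<in> to_fract ` ideal.span S"
      by (intro image_eqI[of _ _ "x' + y'"]) (auto intro: ideal.span_add)
  next
    fix c x assume "x \<in> to_fract ` ideal.span S"
    then obtain x' where "x' \<in> ideal.span S" "x = to_fract x'" by blast
    then show "to_fract c * x \<in> to_fract ` ideal.span S"
      by (intro image_eqI[of _ _ "c * x'"]) (auto intro: ideal.span_scale)
  qed
  then have "fracmod.span (to_fract ` S) \<subseteq> to_fract ` ideal.span S"
    by (intro fracmod.span_minimal) (auto intro: ideal.span_base)
  ultimately show "y \<in> to_fract ` ideal.span S" by blast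
qed

section \<open>Products and inverses of fractional ideals\<close>

lemma ideal_mult_subspace [simp]: "fracmod.subspace (ideal_mult I J)"
  unfolding ideal_mult_def by simp

lemma ideal_mult_memI: "x \<in> I \<Longrightarrow> y \<in> J \<Longrightarrow> x * y \<in> ideal_mult I J"
  unfolding ideal_mult_def by (intro fracmod.span_base) blast

lemma ideal_mult_least:
  assumes "fracmod.subspace K" "\<And>x y. x \<in> I \<Longrightarrow> y \<in> J \<Longrightarrow> x * y \<in> K"
  shows "ideal_mult I J \<subseteq> K"
  unfolding ideal_mult_def using assms by (intro fracmod.span_minimal) auto

lemma ideal_mult_mono: "I \<subseteq> I' \<Longrightarrow> J \<subseteq> J' \<Longrightarrow> ideal_mult I J \<subseteq> ideal_mult I' J'"
  by (intro ideal_mult_least) (auto intro: ideal_mult_memI)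

lemma ideal_mult_commute: "ideal_mult I J = ideal_mult J I"
  unfolding ideal_mult_def by (rule arg_cong[of _ _ fracmod.span]) (auto, (metis mult.commute)+)

lemma ideal_mult_assoc_subset: "ideal_mult (ideal_mult I J) K \<subseteq> ideal_mult I (ideal_mult J K)"
proof (rule ideal_mult_least)
  fix w z assume w: "w \<in> ideal_mult I J" and z: "z \<in> K"
  have "ideal_mult I J \<subseteq> {w. z * w \<in> ideal_mult I (ideal_mult J K)}"
  proof (intro ideal_mult_least fracmod_subspace_vimage ideal_mult_subspace CollectI)
    fix x y assume "x \<in> I" "y \<in> J"
    with z have "x * (y * z) \<in> ideal_mult I (ideal_mult J K)" by (intro ideal_mult_memI)
    then show "z * (x * y) \<in> ideal_mult I (ideal_mult J K)" by (simp add: mult_ac)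
  qed
  with w show "w * z \<in> ideal_mult I (ideal_mult J K)" by (auto simp: mult.commute)
qed simp

lemma ideal_mult_assoc: "ideal_mult (ideal_mult I J) K = ideal_mult I (ideal_mult J K)"
proof
  show "ideal_mult (ideal_mult I J) K \<subseteq> ideal_mult I (ideal_mult J K)"
    by (rule ideal_mult_assoc_subset)
  \<comment> \<open>The inclusion already proved, for the factors in reverse order, is the converse
    one up to commutativity.\<close>
  have "ideal_mult (ideal_mult K J) I \<subseteq> ideal_mult K (ideal_mult J I)"
    by (rule ideal_mult_assoc_subset)
  then show "ideal_mult I (ideal_mult J K) \<subseteq> ideal_mult (ideal_mult I J) K"
    by (simp only: ideal_mult_commute)
qed

lemma ideal_mult_unit:
  assumes "fracmod.subspace I"
  shows "ideal_mult I unit_ideal = I" "ideal_mult unit_ideal I = I"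
proof -
  have "ideal_mult I unit_ideal \<subseteq> I"
    using assms by (intro ideal_mult_least) (auto intro: subspace_imp_fracmod_mult)
  moreover have "I \<subseteq> ideal_mult I unit_ideal"
  proof
    fix x assume "x \<in> I"
    from ideal_mult_memI[OF this one_in_unit_ideal] show "x \<in> ideal_mult I unit_ideal" by simp
  qed
  ultimately show "ideal_mult I unit_ideal = I" by blast
  then show "ideal_mult unit_ideal I = I" by (simp add: ideal_mult_commute)
qed

lemma fractional_ideal_mult:
  assumes "fractional_ideal I" "fractional_ideal J"
  shows "fractional_ideal (ideal_mult I J)"
proof -
  obtain c where c: "c \<noteq> 0" "\<And>x. x \<in> I \<Longrightarrow> to_fract c * x \<in> unit_ideal"
    using assms(1) unfolding fractional_ideal_def unit_ideal_eq by blast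
  obtain d where d: "d \<noteq> 0" "\<And>x. x \<in> J \<Longrightarrow> to_fract d * x \<in> unit_ideal"
    using assms(2) unfolding fractional_ideal_def unit_ideal_eq by blast
  have u: "fracmod.subspace unit_ideal" by (simp add: unit_ideal_def)
  have "ideal_mult I J \<subseteq> {w. to_fract (c * d) * w \<in> unit_ideal}"
  proof (intro ideal_mult_least fracmod_subspace_vimage CollectI u)
    fix x y assume "x \<in> I" "y \<in> J"
    then have "(to_fract c * x) * (to_fract d * y) \<in> unit_ideal"
      by (intro subspace_imp_fracmod_mult[OF u, of "to_fract c * x"] c(2) d(2))
    then show "to_fract (c * d) * (x * y) \<in> unit_ideal" by (simp add: mult_ac)
  qed
  then show ?thesis
    unfolding fractional_ideal_def using c(1) d(1)
    by (intro conjI ideal_mult_subspace exI[of _ "c * d"]) (auto simp: unit_ideal_eq)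
qed

lemma invertible_idealD:
  assumes "invertible_ideal I"
  shows "fracmod.subspace I" "\<exists>J. invertible_ideal J \<and> ideal_mult I J = unit_ideal"
proof -
  show "fracmod.subspace I" using assms unfolding invertible_ideal_def fractional_ideal_def by blast
  show "\<exists>J. invertible_ideal J \<and> ideal_mult I J = unit_ideal"
    using assms unfolding invertible_ideal_def by (metis ideal_mult_commute)
qed

lemma invertible_ideal_mult:
  assumes "invertible_ideal I" "invertible_ideal J"
  shows "invertible_ideal (ideal_mult I J)"
proof -
  obtain I' where I': "fractional_ideal I'" "ideal_mult I I' = unit_ideal"
    using assms(1) unfolding invertible_ideal_def by blast
  obtain J' where J': "fractional_ideal J'" "ideal_mult J J' = unit_ideal"
    using assms(2) unfolding invertible_ideal_def by blast
  have "ideal_mult (ideal_mult I J) (ideal_mult J' I') = ideal_mult I (ideal_mult (ideal_mult J J') I')"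
    by (simp add: ideal_mult_assoc)
  also have "\<dots> = unit_ideal"
    using I' J' by (simp add: ideal_mult_unit fractional_ideal_def)
  finally show ?thesis
    using assms I'(1) J'(1) unfolding invertible_ideal_def by (meson fractional_ideal_mult)
qed

lemma invertible_unit_ideal: "invertible_ideal unit_ideal"
proof -
  have s: "fracmod.subspace unit_ideal" by (simp add: unit_ideal_def)
  have "fractional_ideal unit_ideal"
    unfolding fractional_ideal_def using s by (auto simp: unit_ideal_eq intro!: exI[of _ 1])
  then show ?thesis unfolding invertible_ideal_def using ideal_mult_unit(1)[OF s] by blast
qed

lemma invertible_ideal_nonzero:
  assumes "invertible_ideal (I :: 'a :: idom fract set)"
  shows "\<exists>x \<in> I. x \<noteq> 0"
proof (rule ccontr)
  assume "\<not> (\<exists>x \<in> I. x \<noteq> 0)"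
  then have I: "x = 0" if "x \<in> I" for x using that by blast
  obtain J where J: "ideal_mult I J = unit_ideal" using invertible_idealD(2)[OF assms] by blast
  have "ideal_mult I J \<subseteq> {0}" by (intro ideal_mult_least) (auto dest: I)
  then have "(1 :: 'a fract) \<in> {0}" unfolding J using one_in_unit_ideal by (rule subsetD)
  then show False by simp
qed

text \<open>If \<open>1\<close> is a finite sum of products \<open>p * y\<close> with
  \<open>p\<close> in \<open>I\<close> and \<open>y\<close> in the inverse \<open>J\<close>, then
  every \<open>x\<close> in \<open>I\<close> is the sum of the \<open>p * (x * y)\<close>, and all
  \<open>x * y\<close> lie in the ring; so the \<open>p\<close> that occur generate
  \<open>I\<close>.\<close>

lemma invertible_ideal_finitely_generated:
  assumes "invertible_ideal I"
  shows "\<exists>P. finite P \<and> I = fracmod.span P"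
proof -
  obtain J where J: "ideal_mult I J = unit_ideal" using invertible_idealD(2)[OF assms] by blast
  note I = invertible_idealD(1)[OF assms]
  \<comment> \<open>The elements that need only finitely many members of \<open>I\<close>. This is a
    submodule containing all products, hence \<open>1\<close>, and no explicit finite sum has to be
    handled.\<close>
  let ?K = "{w. \<exists>P. finite P \<and> P \<subseteq> I \<and> w \<in> ideal_mult P J}"
  have "fracmod.subspace ?K"
    unfolding fracmod.subspace_def
  proof (intro conjI ballI allI)
    show "0 \<in> ?K" using fracmod.subspace_0[OF ideal_mult_subspace, of "{}" J] by blast
  next
    fix v w assume "v \<in> ?K" "w \<in> ?K"
    then obtain P Q where *: "finite P" "P \<subseteq> I" "v \<in> ideal_mult P J" "finite Q" "Q \<subseteq> I" "w \<in> ideal_mult Q J"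
      by blast
    have "ideal_mult P J \<subseteq> ideal_mult (P \<union> Q) J" "ideal_mult Q J \<subseteq> ideal_mult (P \<union> Q) J"
      by (intro ideal_mult_mono; blast)+
    with * have "v + w \<in> ideal_mult (P \<union> Q) J"
      by (intro fracmod.subspace_add[OF ideal_mult_subspace]) auto
    moreover have "finite (P \<union> Q)" "P \<union> Q \<subseteq> I" using * by auto
    ultimately show "v + w \<in> ?K" by blast
  next
    fix c w assume "w \<in> ?K"
    then show "to_fract c * w \<in> ?K"
      using fracmod.subspace_scale[OF ideal_mult_subspace] by blast
  qed
  then have "ideal_mult I J \<subseteq> ?K"
  proof (rule ideal_mult_least)
    fix x y assume "x \<in> I" "y \<in> J"
    then show "x * y \<in> ?K"
      using ideal_mult_memI[of x "{x}" y J] by (intro CollectI exI[of _ "{x}"]) auto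
  qed
  then obtain P where P: "finite P" "P \<subseteq> I" "1 \<in> ideal_mult P J"
    unfolding J using one_in_unit_ideal by blast
  have "I \<subseteq> fracmod.span P"
  proof
    fix x assume x: "x \<in> I"
    have "ideal_mult P J \<subseteq> {w. x * w \<in> fracmod.span P}"
    proof (intro ideal_mult_least fracmod_subspace_vimage CollectI)
      fix p y assume "p \<in> P" "y \<in> J"
      then have "p * (x * y) \<in> fracmod.span P"
        using ideal_mult_memI[OF x, of y J] unfolding J
        by (intro subspace_imp_fracmod_mult[of _ p "x * y"] fracmod.subspace_span fracmod.span_base)
      then show "x * (p * y) \<in> fracmod.span P" by (simp add: mult_ac)
    qed simp
    with P(3) show "x \<in> fracmod.span P" by auto
  qed
  moreover have "fracmod.span P \<subseteq> I" by (rule fracmod.span_minimal[OF P(2) I])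
  ultimately show ?thesis using P(1) by blast
qed

section \<open>Finitely generated fractional ideals over a Pruefer domain\<close>

lemma common_denominator:
  fixes P :: "'a :: idom fract set"
  assumes "finite P"
  shows "\<exists>d. d \<noteq> 0 \<and> (\<forall>x\<in>P. to_fract d * x \<in> range to_fract)"
  using assms
proof (induction P rule: finite_induct)
  case empty
  then show ?case by (auto intro: exI[of _ 1])
next
  case (insert x P)
  then obtain d where d: "d \<noteq> 0" "\<And>x. x \<in> P \<Longrightarrow> to_fract d * x \<in> range to_fract" by blast
  obtain a b where x: "x = Fract a b" "b \<noteq> 0" by (cases x) auto
  have "to_fract b * x = to_fract a"
    using x by (simp add: Fract_conv_to_fract)
  then have "to_fract (d * b) * x = to_fract (d * a)" by (simp add: mult.assoc)
  then have "to_fract (d * b) * x \<in> range to_fract" by (rule range_eqI)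
  moreover have "to_fract (d * b) * y \<in> range to_fract" if y: "y \<in> P" for y
  proof -
    obtain z where "to_fract d * y = to_fract z" using d(2)[OF y] by (rule rangeE)
    then have "to_fract (d * b) * y = to_fract (z * b)" by (simp add: mult_ac)
    then show ?thesis by blast
  qed
  ultimately show ?case using d(1) x(2) by (intro exI[of _ "d * b"]) auto
qed

lemma fracmod_span_scale:
  assumes "x \<in> fracmod.span P"
  shows "c * x \<in> fracmod.span ((*) c ` P)"
proof -
  have "fracmod.span P \<subseteq> {x. c * x \<in> fracmod.span ((*) c ` P)}"
    by (intro fracmod.span_minimal fracmod_subspace_vimage fracmod.subspace_span)
      (auto intro: fracmod.span_base)
  with assms show ?thesis by blast
qed

text \<open>The definition of a Pruefer domain speaks of ideals inside the ring. A common
  denominator \<open>d\<close> of the generators moves the module there, and the inverse of the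
  scaled module, itself scaled by \<open>d\<close>, is an inverse of the original one.\<close>

lemma pruefer_invertible_span:
  fixes P :: "'a :: idom fract set"
  assumes pr: "pruefer_domain TYPE('a)" and P: "finite P" "x \<in> P" "x \<noteq> 0"
  shows "invertible_ideal (fracmod.span P)"
proof -
  obtain d where d: "d \<noteq> 0" "\<And>x. x \<in> P \<Longrightarrow> to_fract d * x \<in> range to_fract"
    using common_denominator[OF P(1)] by blast
  define f where "f = (\<lambda>x. SOME y. to_fract d * x = to_fract y)"
  have f: "to_fract d * x = to_fract (f x)" if "x \<in> P" for x
    unfolding f_def using d(2)[OF that] by (intro someI_ex[of "\<lambda>y. to_fract d * x = to_fract y"]) blast
  have fP: "to_fract ` f ` P = (*) (to_fract d) ` P"
    unfolding image_image using f by (intro image_cong) auto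
  have "f x \<noteq> 0" using f[OF P(2)] d(1) P(3) by auto
  moreover have "f x \<in> ideal.span (f ` P)" using P(2) by (intro ideal.span_base) auto
  ultimately have "ideal.span (f ` P) \<noteq> {0}" by blast
  with pr P(1) have "invertible_ideal (to_fract ` ideal.span (f ` P))"
    unfolding pruefer_domain_def by simp
  then have "invertible_ideal (fracmod.span ((*) (to_fract d) ` P))" (is "invertible_ideal ?dP")
    unfolding to_fract_image_span fP .
  then obtain J where J: "invertible_ideal J" "ideal_mult ?dP J = unit_ideal"
    using invertible_idealD(2) by blast
  let ?J = "(*) (to_fract d) ` J"
  have Js: "fracmod.subspace ?J"
  proof -
    have "?J = {z. inverse (to_fract d) * z \<in> J}"
    proof (intro equalityI subsetI)
      fix z assume z: "z \<in> {z. inverse (to_fract d) * z \<in> J}"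
      then show "z \<in> ?J"
        using d(1) by (intro image_eqI[of _ _ "inverse (to_fract d) * z"]) (auto simp: mult.assoc[symmetric])
    qed (use d(1) in \<open>auto simp: mult.assoc[symmetric]\<close>)
    then show ?thesis using fracmod_subspace_vimage[OF invertible_idealD(1)[OF J(1)]] by simp
  qed
  have "fractional_ideal ?J"
  proof -
    have "fractional_ideal J" using J(1) unfolding invertible_ideal_def by blast
    then obtain c where c: "c \<noteq> 0" "\<And>x. x \<in> J \<Longrightarrow> to_fract c * x \<in> unit_ideal"
      unfolding fractional_ideal_def unit_ideal_eq by blast
    have "to_fract c * (to_fract d * x) \<in> range to_fract" if x: "x \<in> J" for x
    proof -
      have "to_fract d * (to_fract c * x) \<in> unit_ideal"
        unfolding unit_ideal_def
        using c(2)[OF x] unfolding unit_ideal_def by (rule fracmod.span_scale)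
      then show ?thesis by (simp add: unit_ideal_eq mult_ac)
    qed
    then show ?thesis
      unfolding fractional_ideal_def using Js c(1) by blast
  qed
  moreover have "fractional_ideal (fracmod.span P)"
  proof -
    have "fracmod.span P \<subseteq> {x. to_fract d * x \<in> unit_ideal}"
      using d(2) invertible_idealD(1)[OF invertible_unit_ideal]
      by (intro fracmod.span_minimal fracmod_subspace_vimage) (auto simp: unit_ideal_eq)
    then show ?thesis unfolding fractional_ideal_def unit_ideal_eq using d(1) by auto
  qed
  moreover have "ideal_mult (fracmod.span P) ?J = unit_ideal"
  proof
    show "ideal_mult (fracmod.span P) ?J \<subseteq> unit_ideal"
    proof (rule ideal_mult_least)
      fix x y assume x: "x \<in> fracmod.span P" and "y \<in> ?J"
      then obtain y' where y': "y' \<in> J" "y = to_fract d * y'" by blast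
      have "(to_fract d * x) * y' \<in> unit_ideal"
        using ideal_mult_memI[OF fracmod_span_scale[OF x] y'(1)] J(2) by blast
      then show "x * y \<in> unit_ideal" unfolding y' by (simp add: mult_ac)
    qed (simp add: unit_ideal_def)
    have "?dP \<subseteq> {w. \<forall>y\<in>J. w * y \<in> ideal_mult (fracmod.span P) ?J}"
    proof (rule fracmod.span_minimal)
      have "to_fract d * p * y \<in> ideal_mult (fracmod.span P) ?J" if "p \<in> P" "y \<in> J" for p y
      proof -
        have "p * (to_fract d * y) \<in> ideal_mult (fracmod.span P) ?J"
          using that by (intro ideal_mult_memI imageI fracmod.span_base)
        then show ?thesis by (simp only: mult_ac)
      qed
      then show "(*) (to_fract d) ` P \<subseteq> {w. \<forall>y\<in>J. w * y \<in> ideal_mult (fracmod.span P) ?J}" by blast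
      have "{w. \<forall>y\<in>J. w * y \<in> ideal_mult (fracmod.span P) ?J} = (\<Inter>y\<in>J. {w. y * w \<in> ideal_mult (fracmod.span P) ?J})"
        by (auto simp: mult.commute)
      then show "fracmod.subspace {w. \<forall>y\<in>J. w * y \<in> ideal_mult (fracmod.span P) ?J}"
        by (simp only: fracmod.subspace_Int fracmod_subspace_vimage ideal_mult_subspace)
    qed
    then have "ideal_mult ?dP J \<subseteq> ideal_mult (fracmod.span P) ?J"
      by (intro ideal_mult_least ideal_mult_subspace) blast
    then show "unit_ideal \<subseteq> ideal_mult (fracmod.span P) ?J" using J(2) by simp
  qed
  ultimately show ?thesis unfolding invertible_ideal_def by blast
qed

text \<open>Write \<open>1 = a * x + b * y\<close> with \<open>x\<close>, \<open>y\<close> in the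
  inverse of the ideal generated by \<open>a\<close> and \<open>b\<close>. Then
  \<open>s = b * y\<close>, \<open>1 - s = a * x\<close>, \<open>u = a * y\<close> and
  \<open>v = b * x\<close> all lie in the ring, and the identities reduce to commutativity.\<close>

lemma pruefer_arithmetical:
  fixes a b :: "'a :: idom"
  assumes pr: "pruefer_domain TYPE('a)"
  shows "\<exists>s u v. s * a = u * b \<and> (1 - s) * b = v * a"
proof (cases "a = 0 \<and> b = 0")
  case False
  let ?I = "to_fract ` ideal.span {a, b}"
  have "a \<in> ideal.span {a, b}" "b \<in> ideal.span {a, b}" by (auto intro: ideal.span_base)
  with False have "ideal.span {a, b} \<noteq> {0}" by blast
  then have "invertible_ideal ?I" using pr unfolding pruefer_domain_def by simp
  then obtain J where J: "invertible_ideal J" "ideal_mult ?I J = unit_ideal"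
    using invertible_idealD(2) by blast
  note Js = invertible_idealD(1)[OF J(1)]
  have ab: "to_fract a * x \<in> range to_fract" "to_fract b * x \<in> range to_fract" if "x \<in> J" for x
  proof -
    have "to_fract a \<in> ?I" "to_fract b \<in> ?I" by (auto intro: ideal.span_base)
    from this[THEN ideal_mult_memI, OF that] show "to_fract a * x \<in> range to_fract" "to_fract b * x \<in> range to_fract"
      unfolding J(2) unit_ideal_eq by auto
  qed
  let ?K = "{w. \<exists>x\<in>J. \<exists>y\<in>J. w = to_fract a * x + to_fract b * y}"
  have K: "fracmod.subspace ?K" by (rule fracmod_subspace_combinations[OF Js Js])
  have "ideal_mult ?I J \<subseteq> ?K"
  proof (rule ideal_mult_least[OF K])
    fix z x assume "z \<in> ?I" and x: "x \<in> J"
    then obtain p q where z: "z = to_fract p * to_fract a + to_fract q * to_fract b"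
      unfolding image_iff Bex_def ideal_span_pair by auto
    have "to_fract p * x \<in> J" "to_fract q * x \<in> J"
      using fracmod.subspace_scale[OF Js x] by auto
    then show "z * x \<in> ?K" unfolding z
      by (intro CollectI bexI[of _ "to_fract p * x"] bexI[of _ "to_fract q * x"]) (auto simp: algebra_simps)
  qed
  then obtain x y where xy: "x \<in> J" "y \<in> J" "1 = to_fract a * x + to_fract b * y"
    unfolding J(2) using one_in_unit_ideal by blast
  obtain r s u v where r: "to_fract a * x = to_fract r" "to_fract b * y = to_fract s"
    "to_fract a * y = to_fract u" "to_fract b * x = to_fract v"
    using ab[OF xy(1)] ab[OF xy(2)] by (auto simp: image_iff)
  have "to_fract 1 = to_fract (r + s)" using xy(3) r by simp
  then have rs: "r = 1 - s" unfolding to_fract_eq_iff by (simp add: algebra_simps)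
  have "to_fract (s * a) = to_fract (u * b)" by (simp add: r[symmetric] mult_ac)
  moreover have "to_fract (r * b) = to_fract (v * a)" by (simp add: r[symmetric] mult_ac)
  ultimately show ?thesis unfolding rs to_fract_eq_iff by blast
qed (auto intro: exI[of _ 0])

subsection \<open>Column reduction of pseudo-matrices\<close>

text \<open>\<open>C\<close> is an invertible pseudo-matrix with row ideals \<open>h\<close>, column ideals \<open>e\<close> and inverse \<open>D\<close>.\<close>

definition pseudo_iso ::
    "'a :: idom fract set list \<Rightarrow> 'a fract set list \<Rightarrow> 'a fract mat \<Rightarrow> 'a fract mat \<Rightarrow> bool" where
  "pseudo_iso h e C D \<longleftrightarrow> length e = length h \<and> (\<forall>I \<in> set h \<union> set e. invertible_ideal I) \<and>
     C \<in> carrier_mat (length h) (length h) \<and> D \<in> carrier_mat (length h) (length h) \<and>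
     C * D = 1\<^sub>m (length h) \<and> D * C = 1\<^sub>m (length h) \<and>
     (\<forall>i < length h. \<forall>j < length h.
        (\<forall>x \<in> e ! j. C $$ (i, j) * x \<in> h ! i) \<and> (\<forall>x \<in> h ! j. D $$ (i, j) * x \<in> e ! i))"

lemma pseudo_iso_imp_invertible:
  assumes "pseudo_iso h e C D"
  shows "pseudo_invertible \<lparr>row_ideals = h, col_ideals = e, entries = C\<rparr>"
  unfolding pseudo_invertible_def
proof (intro conjI exI[of _ D])
  show "inverts_mat (entries \<lparr>row_ideals = h, col_ideals = e, entries = C\<rparr>) D"
    "inverts_mat D (entries \<lparr>row_ideals = h, col_ideals = e, entries = C\<rparr>)"
    using assms unfolding pseudo_iso_def inverts_mat_def by auto
qed (use assms in \<open>auto simp: pseudo_iso_def is_pseudo_matrix_def\<close>)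

lemma pseudo_iso_refl:
  assumes "\<forall>I \<in> set h. invertible_ideal I"
  shows "pseudo_iso h h (1\<^sub>m (length h)) (1\<^sub>m (length h))"
proof -
  have "0 \<in> h ! i" if "i < length h" for i
    using that assms by (intro fracmod.subspace_0 invertible_idealD(1)) simp
  then show ?thesis using assms unfolding pseudo_iso_def by auto
qed

lemma mult_entry_closed:
  assumes "A \<in> carrier_mat k l" "B \<in> carrier_mat l m" "i < k" "j < m" "fracmod.subspace I"
    and "\<And>y p. p < l \<Longrightarrow> y \<in> g ! p \<Longrightarrow> A $$ (i, p) * y \<in> I"
    and "\<And>p. p < l \<Longrightarrow> B $$ (p, j) * x \<in> g ! p"
  shows "(A * B) $$ (i, j) * x \<in> I"
proof -
  have "(A * B) $$ (i, j) * x = (\<Sum>p = 0..<l. A $$ (i, p) * (B $$ (p, j) * x))"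
    using assms(1-4) by (simp add: scalar_prod_def sum_distrib_right mult.assoc)
  also have "\<dots> \<in> I" using assms(6,7) by (intro fracmod.subspace_sum[OF assms(5)]) simp
  finally show ?thesis .
qed

lemma pseudo_iso_trans:
  assumes 1: "pseudo_iso h e C D" and 2: "pseudo_iso e f C' D'"
  shows "pseudo_iso h f (C * C') (D' * D)"
proof -
  let ?n = "length h"
  have c: "C \<in> carrier_mat ?n ?n" "D \<in> carrier_mat ?n ?n" "C' \<in> carrier_mat ?n ?n" "D' \<in> carrier_mat ?n ?n"
    and l: "length e = ?n" "length f = ?n"
    and i: "C * D = 1\<^sub>m ?n" "D * C = 1\<^sub>m ?n" "C' * D' = 1\<^sub>m ?n" "D' * C' = 1\<^sub>m ?n"
    using 1 2 unfolding pseudo_iso_def by auto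
  have s: "fracmod.subspace I" if "I \<in> set h \<union> set f" for I
    using that 1 2 unfolding pseudo_iso_def by (auto dest: invertible_idealD(1))
  have "(C * C') $$ (i, j) * x \<in> h ! i" if "i < ?n" "j < ?n" "x \<in> f ! j" for i j x
    by (rule mult_entry_closed[OF c(1,3) that(1,2), of _ e]) (use 1 2 l that s in \<open>auto simp: pseudo_iso_def\<close>)
  moreover have "(D' * D) $$ (i, j) * x \<in> f ! i" if "i < ?n" "j < ?n" "x \<in> h ! j" for i j x
    by (rule mult_entry_closed[OF c(4,2) that(1,2), of _ e]) (use 1 2 l that s in \<open>auto simp: pseudo_iso_def\<close>)
  moreover have "C * C' * (D' * D) = 1\<^sub>m ?n" "D' * D * (C * C') = 1\<^sub>m ?n"
    using c i by (auto intro!: mult_mat_right_inverse)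
  ultimately show ?thesis using 1 2 c l unfolding pseudo_iso_def by auto
qed

definition pair_mat :: "nat \<Rightarrow> nat \<Rightarrow> nat \<Rightarrow> 'a \<Rightarrow> 'a \<Rightarrow> 'a \<Rightarrow> 'a \<Rightarrow> 'a :: comm_ring_1 mat" where
  "pair_mat m p q \<alpha> \<beta> \<gamma> \<epsilon> = mat m m (\<lambda>(i, j).
     if j = p then (if i = p then \<alpha> else if i = q then \<gamma> else 0)
     else if j = q then (if i = p then \<beta> else if i = q then \<epsilon> else 0)
     else if i = j then 1 else 0)"

lemma pair_mat_carrier [simp]: "pair_mat m p q \<alpha> \<beta> \<gamma> \<epsilon> \<in> carrier_mat m m"
  unfolding pair_mat_def by simp

lemma mult_pair_mat:
  assumes A: "A \<in> carrier_mat k m" and pq: "p < m" "q < m" "p \<noteq> q" and ij: "i < k" "j < m"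
  shows "(A * pair_mat m p q \<alpha> \<beta> \<gamma> \<epsilon>) $$ (i, j) =
    (if j = p then A $$ (i, p) * \<alpha> + A $$ (i, q) * \<gamma>
     else if j = q then A $$ (i, p) * \<beta> + A $$ (i, q) * \<epsilon> else A $$ (i, j))"
proof -
  have two: "(\<Sum>l = 0..<m. A $$ (i, l) * (if l = p then c else if l = q then d else 0)) =
      A $$ (i, p) * c + A $$ (i, q) * d" for c d
  proof -
    have "(\<Sum>l = 0..<m. A $$ (i, l) * (if l = p then c else if l = q then d else 0)) =
        (\<Sum>l\<in>{p, q}. A $$ (i, l) * (if l = p then c else if l = q then d else 0))"
      using pq by (intro sum.mono_neutral_right) auto
    then show ?thesis using pq by simp
  qed
  have one: "(\<Sum>l = 0..<m. A $$ (i, l) * (if l = j then 1 else 0)) = A $$ (i, j)"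
    using ij by (simp add: if_distrib[of "\<lambda>x. _ * x"] cong: if_cong)
  have "(A * pair_mat m p q \<alpha> \<beta> \<gamma> \<epsilon>) $$ (i, j) =
      (\<Sum>l = 0..<m. A $$ (i, l) * pair_mat m p q \<alpha> \<beta> \<gamma> \<epsilon> $$ (l, j))"
    using A ij by (simp add: scalar_prod_def pair_mat_def)
  also have "\<dots> = (\<Sum>l = 0..<m. A $$ (i, l) * (if j = p then (if l = p then \<alpha> else if l = q then \<gamma> else 0)
     else if j = q then (if l = p then \<beta> else if l = q then \<epsilon> else 0)
     else if l = j then 1 else 0))"
    using ij by (intro sum.cong) (auto simp: pair_mat_def)
  finally show ?thesis using two one by simp
qed

lemma pair_mat_inverse:
  assumes "p < m" "q < m" "p \<noteq> q"
    and "\<alpha> * \<alpha>' + \<beta> * \<gamma>' = 1" "\<alpha> * \<beta>' + \<beta> * \<epsilon>' = 0" "\<gamma> * \<alpha>' + \<epsilon> * \<gamma>' = 0" "\<gamma> * \<beta>' + \<epsilon> * \<epsilon>' = 1"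
  shows "pair_mat m p q \<alpha> \<beta> \<gamma> \<epsilon> * pair_mat m p q \<alpha>' \<beta>' \<gamma>' \<epsilon>' = 1\<^sub>m m"
proof (rule eq_matI)
  fix i j assume "i < dim_row (1\<^sub>m m :: 'a mat)" "j < dim_col (1\<^sub>m m :: 'a mat)"
  then have ij: "i < m" "j < m" by auto
  show "(pair_mat m p q \<alpha> \<beta> \<gamma> \<epsilon> * pair_mat m p q \<alpha>' \<beta>' \<gamma>' \<epsilon>') $$ (i, j) = 1\<^sub>m m $$ (i, j)"
    unfolding mult_pair_mat[OF pair_mat_carrier assms(1-3) ij]
    using assms ij by (auto simp: pair_mat_def)
qed (auto simp: pair_mat_def)

text \<open>\<aa> is \<open>x I + y J\<close>, handed out through its universal property so that
  generators of \<open>I\<close> and \<open>J\<close> do not appear later. It is finitely generated,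
  and \<open>y \<noteq> 0\<close> makes it nonzero, hence invertible.\<close>

lemma pruefer_ideal_sum:
  fixes I J :: "'a :: idom fract set"
  assumes pr: "pruefer_domain TYPE('a)" and I: "invertible_ideal I" and J: "invertible_ideal J"
    and y: "y \<noteq> 0"
  obtains \<aa> where "invertible_ideal \<aa>" "\<And>z. z \<in> I \<Longrightarrow> x * z \<in> \<aa>" "\<And>z. z \<in> J \<Longrightarrow> y * z \<in> \<aa>"
    "\<And>K. fracmod.subspace K \<Longrightarrow> (\<forall>z\<in>I. x * z \<in> K) \<Longrightarrow> (\<forall>z\<in>J. y * z \<in> K) \<Longrightarrow> \<aa> \<subseteq> K"
proof -
  obtain P where P: "finite P" "I = fracmod.span P"
    using invertible_ideal_finitely_generated[OF I] by blast
  obtain Q where Q: "finite Q" "J = fracmod.span Q"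
    using invertible_ideal_finitely_generated[OF J] by blast
  have "\<exists>z\<in>Q. z \<noteq> 0"
  proof (rule ccontr)
    assume "\<not> (\<exists>z\<in>Q. z \<noteq> 0)"
    then have "fracmod.span Q \<subseteq> {0}" by (intro fracmod.span_minimal) auto
    then show False using invertible_ideal_nonzero[OF J] Q by blast
  qed
  then obtain z where z: "z \<in> Q" "z \<noteq> 0" by blast
  let ?S = "(*) x ` P \<union> (*) y ` Q"
  have "invertible_ideal (fracmod.span ?S)"
    by (rule pruefer_invertible_span[OF pr, where x = "y * z"]) (use P(1) Q(1) y z in auto)
  moreover have "x * z \<in> fracmod.span ?S" if "z \<in> I" for z
    using fracmod_span_scale[of z P x] that fracmod.span_mono[of "(*) x ` P" ?S] unfolding P(2) by blast
  moreover have "y * z \<in> fracmod.span ?S" if "z \<in> J" for z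
    using fracmod_span_scale[of z Q y] that fracmod.span_mono[of "(*) y ` Q" ?S] unfolding Q(2) by blast
  moreover have "fracmod.span ?S \<subseteq> K"
    if "fracmod.subspace K" "\<forall>z\<in>I. x * z \<in> K" "\<forall>z\<in>J. y * z \<in> K" for K
    using that unfolding P(2) Q(2)
    by (intro fracmod.span_minimal) (auto intro: fracmod.span_base)
  ultimately show thesis by (rule that)
qed

text \<open>
  With \<open>\<aa> = x I + y J\<close> and \<open>x s + y t = 1\<close>, where \<open>s \<in> I \<aa>\<^sup>-\<^sup>1\<close> and \<open>t \<in> J \<aa>\<^sup>-\<^sup>1\<close>, the matrix with rows
  \<open>(s, -y)\<close> and \<open>(t, x)\<close> maps \<open>\<aa> \<oplus> I J \<aa>\<^sup>-\<^sup>1\<close> onto \<open>I \<oplus> J\<close> and the row \<open>(x, y)\<close> to \<open>(1, 0)\<close>.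
\<close>

lemma pruefer_bezout:
  fixes I J :: "'a :: idom fract set"
  assumes pr: "pruefer_domain TYPE('a)" and I: "invertible_ideal I" and J: "invertible_ideal J"
    and y: "y \<noteq> 0"
  shows "\<exists>\<aa> \<gg> s t. invertible_ideal \<aa> \<and> invertible_ideal \<gg> \<and> x * s + y * t = 1 \<and>
    (\<forall>z\<in>I. x * z \<in> \<aa> \<and> t * z \<in> \<gg>) \<and> (\<forall>z\<in>J. y * z \<in> \<aa> \<and> s * z \<in> \<gg>) \<and>
    (\<forall>z\<in>\<aa>. s * z \<in> I \<and> t * z \<in> J) \<and> (\<forall>z\<in>\<gg>. y * z \<in> I \<and> x * z \<in> J)"
proof -
  obtain \<aa> where a: "invertible_ideal \<aa>" "\<And>z. z \<in> I \<Longrightarrow> x * z \<in> \<aa>" "\<And>z. z \<in> J \<Longrightarrow> y * z \<in> \<aa>"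
    "\<And>K. fracmod.subspace K \<Longrightarrow> (\<forall>z\<in>I. x * z \<in> K) \<Longrightarrow> (\<forall>z\<in>J. y * z \<in> K) \<Longrightarrow> \<aa> \<subseteq> K"
    by (rule pruefer_ideal_sum[OF pr I J y, of x]) (rule that)
  obtain \<bb> where b: "invertible_ideal \<bb>" "ideal_mult \<aa> \<bb> = unit_ideal"
    using invertible_idealD(2)[OF a(1)] by blast
  note Is = invertible_idealD(1)[OF I] and Js = invertible_idealD(1)[OF J]
  \<comment> \<open>The module \<open>x I \<bb> + y J \<bb>\<close> with \<bb> inverse to \<aa>. It
    contains the product of \<aa> and \<bb>, hence \<open>1\<close>, and a representation of
    \<open>1\<close> in it supplies \<open>s\<close> and \<open>t\<close>.\<close>
  let ?K = "{w. \<exists>s\<in>ideal_mult I \<bb>. \<exists>t\<in>ideal_mult J \<bb>. w = x * s + y * t}"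
  have K: "fracmod.subspace ?K" by (intro fracmod_subspace_combinations ideal_mult_subspace)
  have "ideal_mult \<aa> \<bb> \<subseteq> ?K"
  proof (rule ideal_mult_least[OF K])
    fix z u assume z: "z \<in> \<aa>" and u: "u \<in> \<bb>"
    have "u * (x * z) \<in> ?K" if "z \<in> I" for z
      using ideal_mult_memI[OF that u] fracmod.subspace_0[OF ideal_mult_subspace]
      by (intro CollectI bexI[of _ "z * u"] bexI[of _ 0]) (auto simp: mult_ac)
    moreover have "u * (y * z) \<in> ?K" if "z \<in> J" for z
      using ideal_mult_memI[OF that u] fracmod.subspace_0[OF ideal_mult_subspace]
      by (intro CollectI bexI[of _ 0] bexI[of _ "z * u"]) (auto simp: mult_ac)
    ultimately have "\<aa> \<subseteq> {z. u * z \<in> ?K}"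
      by (intro a(4) fracmod_subspace_vimage K) auto
    with z have "u * z \<in> ?K" by blast
    then show "z * u \<in> ?K" by (simp only: mult.commute)
  qed
  then have "1 \<in> ?K" unfolding b(2) using one_in_unit_ideal by (rule subsetD)
  then obtain s t where s: "s \<in> ideal_mult I \<bb>" and t: "t \<in> ideal_mult J \<bb>" and st: "x * s + y * t = 1"
    by (simp only: mem_Collect_eq) metis
  define \<gg> where "\<gg> = ideal_mult (ideal_mult I \<bb>) J"
  \<comment> \<open>\<gg> is symmetric in \<open>I\<close> and \<open>J\<close>: its definition
    serves the multiples of \<open>s\<close>, this form those of \<open>t\<close>.\<close>
  have g: "\<gg> = ideal_mult (ideal_mult J \<bb>) I"
    unfolding \<gg>_def by (metis ideal_mult_assoc ideal_mult_commute)
  have cancel: "ideal_mult (ideal_mult H \<bb>) \<aa> = H" if "fracmod.subspace H" for H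
    using that b(2) by (simp add: ideal_mult_assoc ideal_mult_commute[of \<bb>] ideal_mult_unit)
  \<comment> \<open>If \<open>c H\<close> lies in \<aa>, then \<open>c H \<bb>\<close> lies in the
    unit ideal and so maps \<open>G\<close> into itself. Taking \<open>y\<close>, \<open>J\<close>,
    \<open>I\<close> and then \<open>x\<close>, \<open>I\<close>, \<open>J\<close> for
    \<open>c\<close>, \<open>H\<close>, \<open>G\<close> gives the two inclusions about
    \<gg>.\<close>
  have aux: "ideal_mult (ideal_mult H \<bb>) G \<subseteq> {z. c * z \<in> G}"
    if H: "\<And>z. z \<in> H \<Longrightarrow> c * z \<in> \<aa>" and G: "fracmod.subspace G" for c H G
  proof (intro ideal_mult_least fracmod_subspace_vimage G CollectI)
    fix v w assume v: "v \<in> ideal_mult H \<bb>" and w: "w \<in> G"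
    have "ideal_mult H \<bb> \<subseteq> {v. c * v \<in> unit_ideal}"
    proof (intro ideal_mult_least fracmod_subspace_vimage CollectI)
      fix h u assume "h \<in> H" "u \<in> \<bb>"
      then have "(c * h) * u \<in> ideal_mult \<aa> \<bb>" using H by (intro ideal_mult_memI)
      then show "c * (h * u) \<in> unit_ideal" unfolding b(2) by (simp add: mult.assoc)
    qed (simp add: unit_ideal_def)
    with v have "w * (c * v) \<in> G" by (intro subspace_imp_fracmod_mult[OF G w]) blast
    then show "c * (v * w) \<in> G" by (simp add: mult_ac)
  qed
  have "s * z \<in> I" if "z \<in> \<aa>" for z using ideal_mult_memI[OF s that] cancel[OF Is] by simp
  moreover have "t * z \<in> J" if "z \<in> \<aa>" for z using ideal_mult_memI[OF t that] cancel[OF Js] by simp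
  moreover have "s * z \<in> \<gg>" if "z \<in> J" for z
    unfolding \<gg>_def by (rule ideal_mult_memI[OF s that])
  moreover have "t * z \<in> \<gg>" if "z \<in> I" for z
    unfolding g by (rule ideal_mult_memI[OF t that])
  moreover have "y * z \<in> I" if "z \<in> \<gg>" for z
    using aux[of J y I] a(3) Is that unfolding g by blast
  moreover have "x * z \<in> J" if "z \<in> \<gg>" for z
    using aux[of I x J] a(2) Js that unfolding \<gg>_def by blast
  moreover have "invertible_ideal \<gg>"
    unfolding \<gg>_def by (intro invertible_ideal_mult I J b)
  ultimately show ?thesis
    using a(1-3) st
    by - (rule exI[of _ \<aa>], rule exI[of _ \<gg>], rule exI[of _ s], rule exI[of _ t], simp)
qed

text \<open>The last clause clears the current row; the one before it protects the rows already
  reduced, which vanish in both columns. Of the matrix only the pair \<open>x\<close>,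
  \<open>y\<close> enters the choice of \<open>C\<close>.\<close>

lemma pseudo_clear_entry:
  fixes e :: "'a :: idom fract set list"
  assumes pr: "pruefer_domain TYPE('a)" and e: "\<forall>I \<in> set e. invertible_ideal I"
    and pq: "p < length e" "q < length e" "p \<noteq> q"
  shows "\<exists>C D e'. pseudo_iso e e' C D \<and> (\<forall>k. \<forall>A \<in> carrier_mat k (length e). \<forall>i<k.
    (\<forall>j<length e. j \<noteq> p \<longrightarrow> j \<noteq> q \<longrightarrow> (A * C) $$ (i, j) = A $$ (i, j)) \<and>
    (A $$ (i, p) = 0 \<longrightarrow> A $$ (i, q) = 0 \<longrightarrow> (A * C) $$ (i, p) = 0 \<and> (A * C) $$ (i, q) = 0) \<and>
    (A $$ (i, p) = x \<longrightarrow> A $$ (i, q) = y \<longrightarrow> (A * C) $$ (i, q) = 0))"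
proof (cases "y = 0")
  case True
  then show ?thesis
    using pseudo_iso_refl[OF e] by (intro exI[of _ "1\<^sub>m (length e)"] exI[of _ e]) auto
next
  case False
  let ?m = "length e"
  have inv: "invertible_ideal (e ! p)" "invertible_ideal (e ! q)" using e pq by auto
  obtain \<aa> \<gg> s t where ag: "invertible_ideal \<aa>" "invertible_ideal \<gg>" and st: "x * s + y * t = 1"
    and m: "\<forall>z\<in>e ! p. x * z \<in> \<aa> \<and> t * z \<in> \<gg>" "\<forall>z\<in>e ! q. y * z \<in> \<aa> \<and> s * z \<in> \<gg>"
      "\<forall>z\<in>\<aa>. s * z \<in> e ! p \<and> t * z \<in> e ! q" "\<forall>z\<in>\<gg>. y * z \<in> e ! p \<and> x * z \<in> e ! q"
    using pruefer_bezout[OF pr inv False, of x] by blast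
  \<comment> \<open>The 2 x 2 block has determinant \<open>x * s + y * t = 1\<close>, so
    \<open>D\<close> carries its adjugate.\<close>
  define C where "C = pair_mat ?m p q s (- y) t x"
  define D where "D = pair_mat ?m p q x y (- t) s"
  define e' where "e' = e[p := \<aa>, q := \<gg>]"
  have CD: "C * D = 1\<^sub>m ?m" "D * C = 1\<^sub>m ?m"
    unfolding C_def D_def using st by (intro pair_mat_inverse pq; simp add: algebra_simps)+
  have e'i: "\<forall>I \<in> set e'. invertible_ideal I"
    using e ag set_update_subset_insert[of "e[p := \<aa>]" q \<gg>] set_update_subset_insert[of e p \<aa>]
    unfolding e'_def by blast
  have sub: "fracmod.subspace (e ! i)" "fracmod.subspace (e' ! i)" if "i < ?m" for i
  proof -
    have "e ! i \<in> set e" "e' ! i \<in> set e'" using that unfolding e'_def by (auto intro!: nth_mem)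
    then show "fracmod.subspace (e ! i)" "fracmod.subspace (e' ! i)"
      using e e'i invertible_idealD(1) by blast+
  qed
  have e'n: "e' ! i = (if i = q then \<gg> else if i = p then \<aa> else e ! i)" if "i < ?m" for i
    using that pq unfolding e'_def by (auto simp: nth_list_update)
  have neg: "- z \<in> e ! i \<longleftrightarrow> z \<in> e ! i" "- z \<in> e' ! i \<longleftrightarrow> z \<in> e' ! i" if "i < ?m" for z i
    using sub[OF that] fracmod.subspace_neg by force+
  have zero: "0 \<in> e ! i" "0 \<in> e' ! i" if "i < ?m" for i
    using sub[OF that] fracmod.subspace_0 by auto
  have "C $$ (i, j) * z \<in> e ! i" if ij: "i < ?m" "j < ?m" and z: "z \<in> e' ! j" for i j z
    using m pq ij z zero(1) neg(1) unfolding C_def pair_mat_def e'n[OF ij(2)] by (auto split: if_splits)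
  moreover have "D $$ (i, j) * z \<in> e' ! i" if ij: "i < ?m" "j < ?m" and z: "z \<in> e ! j" for i j z
    using m pq ij z zero(2)[OF ij(1)] neg(2)[OF ij(1)] unfolding D_def pair_mat_def
    by (auto simp: e'n split: if_splits)
  ultimately have iso: "pseudo_iso e e' C D"
    unfolding pseudo_iso_def using CD e e'i by (auto simp: e'_def C_def D_def)
  have AC: "(A * C) $$ (i, j) = (if j = p then A $$ (i, p) * s + A $$ (i, q) * t
     else if j = q then A $$ (i, p) * (- y) + A $$ (i, q) * x else A $$ (i, j))"
    if "A \<in> carrier_mat k ?m" "i < k" "j < ?m" for A k i j
    unfolding C_def using mult_pair_mat[OF that(1) pq that(2,3)] .
  have "(\<forall>j<?m. j \<noteq> p \<longrightarrow> j \<noteq> q \<longrightarrow> (A * C) $$ (i, j) = A $$ (i, j)) \<and>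
    (A $$ (i, p) = 0 \<longrightarrow> A $$ (i, q) = 0 \<longrightarrow> (A * C) $$ (i, p) = 0 \<and> (A * C) $$ (i, q) = 0) \<and>
    (A $$ (i, p) = x \<longrightarrow> A $$ (i, q) = y \<longrightarrow> (A * C) $$ (i, q) = 0)"
    if A: "A \<in> carrier_mat k ?m" "i < k" for A k i
    using AC[OF A] pq by (auto simp: mult.commute)
  with iso show ?thesis by blast
qed

text \<open>In row \<open>r\<close> the entry in each column \<open>q > r\<close> is cleared against
  the diagonal column \<open>r\<close>. The rows above vanish in both columns, since
  \<open>i < r < q\<close>, and so stay reduced. A zero diagonal entry is no exception.\<close>

lemma exists_lower_trapezoidal:
  fixes e :: "'a :: idom fract set list"
  assumes pr: "pruefer_domain TYPE('a)" and e: "\<forall>I \<in> set e. invertible_ideal I"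
    and A: "A \<in> carrier_mat n (length e)"
  shows "\<exists>C D e'. pseudo_iso e e' C D \<and> (\<forall>i<n. \<forall>j<length e. i < j \<longrightarrow> (A * C) $$ (i, j) = 0)"
proof -
  let ?m = "length e"
  let ?cleared = "\<lambda>r q C. \<forall>i<n. \<forall>j<?m. i < j \<longrightarrow> (i < r \<or> i = r \<and> j < q) \<longrightarrow> (A * C) $$ (i, j) = 0"
  have row: "\<exists>C D e'. pseudo_iso e e' C D \<and> ?cleared r q C"
    if r: "r < n" and start: "\<exists>C D e'. pseudo_iso e e' C D \<and> ?cleared r 0 C" and "q \<le> ?m" for r q
    using \<open>q \<le> ?m\<close>
  proof (induction q)
    case 0
    show ?case by (rule start)
  next
    case (Suc q)
    then obtain C D e' where C: "pseudo_iso e e' C D" and cl: "?cleared r q C" by auto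
    show ?case
    proof (cases "r < q")
      case False
      then have "?cleared r (Suc q) C" using cl by (auto simp: less_Suc_eq)
      with C show ?thesis by blast
    next
      case True
      have l: "length e' = ?m" and e': "\<forall>I \<in> set e'. invertible_ideal I" and Cc: "C \<in> carrier_mat ?m ?m"
        using C unfolding pseudo_iso_def by auto
      have AC: "A * C \<in> carrier_mat n ?m" using A Cc by auto
      have "r < length e'" "q < length e'" "r \<noteq> q" using True Suc.prems l by auto
      from pseudo_clear_entry[OF pr e' this, of "(A * C) $$ (r, r)" "(A * C) $$ (r, q)", unfolded l]
      obtain C' D' e'' where C': "pseudo_iso e' e'' C' D'"
        and B: "\<And>k B i. B \<in> carrier_mat k ?m \<Longrightarrow> i < k \<Longrightarrow>
          (\<forall>j<?m. j \<noteq> r \<longrightarrow> j \<noteq> q \<longrightarrow> (B * C') $$ (i, j) = B $$ (i, j)) \<and>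
          (B $$ (i, r) = 0 \<longrightarrow> B $$ (i, q) = 0 \<longrightarrow> (B * C') $$ (i, r) = 0 \<and> (B * C') $$ (i, q) = 0) \<and>
          (B $$ (i, r) = (A * C) $$ (r, r) \<longrightarrow> B $$ (i, q) = (A * C) $$ (r, q) \<longrightarrow> (B * C') $$ (i, q) = 0)"
        by blast
      note B = B[OF AC]
      have "C' \<in> carrier_mat ?m ?m" using C' l unfolding pseudo_iso_def by auto
      then have assoc: "A * (C * C') = A * C * C'"
        using A Cc by (intro assoc_mult_mat[symmetric]) auto
      have "?cleared r (Suc q) (C * C')"
        unfolding assoc
      proof (intro allI impI)
        fix i j assume ij: "i < n" "j < ?m" "i < j" "i < r \<or> i = r \<and> j < Suc q"
        note Bi = B[OF ij(1)]
        from ij(4) show "(A * C * C') $$ (i, j) = 0"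
        proof
          assume "i < r"
          then have z: "(A * C) $$ (i, l) = 0" if "l < ?m" "i < l" for l
            using cl ij(1) that by blast
          have "(A * C) $$ (i, r) = 0" "(A * C) $$ (i, q) = 0"
            using z \<open>i < r\<close> True Suc.prems by auto
          then show ?thesis using Bi z[OF ij(2,3)] ij(2) by metis
        next
          assume *: "i = r \<and> j < Suc q"
          show ?thesis
          proof (cases "j = q")
            case True
            then show ?thesis using Bi * by blast
          next
            case False
            with * have "j < q" by simp
            then have "(A * C) $$ (i, j) = 0" using cl ij * by blast
            then show ?thesis using Bi * ij(2,3) False by (metis less_irrefl)
          qed
        qed
      qed
      with pseudo_iso_trans[OF C C'] show ?thesis by blast
    qed
  qed
  have "\<exists>C D e'. pseudo_iso e e' C D \<and> ?cleared r 0 C" if "r \<le> n" for r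
    using that
  proof (induction r)
    case 0
    show ?case using pseudo_iso_refl[OF e] by (intro exI) auto
  next
    case (Suc r)
    then obtain C D e' where C: "pseudo_iso e e' C D" and cl: "?cleared r ?m C"
      using row[of r ?m] by auto
    have "?cleared (Suc r) 0 C" using cl by (auto simp: less_Suc_eq)
    with C show ?case by blast
  qed
  from this[of n] show ?thesis by auto
qed

subsection \<open>Determinantal ideals\<close>

lemma submatrix_all_rows:
  assumes M: "M \<in> carrier_mat n m" and J: "J \<subseteq> {..<m}" "card J = k"
  shows "submatrix M {..<n} J \<in> carrier_mat n k"
    and "\<And>i j. i < n \<Longrightarrow> j < k \<Longrightarrow> submatrix M {..<n} J $$ (i, j) = M $$ (i, pick J j)"
    and "\<And>j. j < k \<Longrightarrow> pick J j < m"
proof -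
  have r: "{i. i < dim_row M \<and> i \<in> {..<n}} = {..<n}" and c: "{j. j < dim_col M \<and> j \<in> J} = J"
    using M J by auto
  show "submatrix M {..<n} J \<in> carrier_mat n k"
    by (rule carrier_matI) (simp_all only: dim_submatrix r c J(2) card_lessThan)
  show "submatrix M {..<n} J $$ (i, j) = M $$ (i, pick J j)" if "i < n" "j < k" for i j
  proof -
    have "pick {..<n} (card {a \<in> {..<n}. a < i}) = i"
      using that by (intro pick_card_in_set) simp
    moreover have "{a \<in> {..<n}. a < i} = {..<i}" using that by auto
    ultimately have "pick {..<n} i = i" by simp
    moreover have "submatrix M {..<n} J $$ (i, j) = M $$ (pick {..<n} i, pick J j)"
      by (rule submatrix_index) (simp_all only: r c J(2) card_lessThan that)
    ultimately show ?thesis by simp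
  qed
  show "pick J j < m" if "j < k" for j
  proof (rule pick_le)
    have "{a. a < m \<and> a \<in> J} = J" using J by auto
    then show "j < card {a. a < m \<and> a \<in> J}" using that J(2) by simp
  qed
qed

text \<open>Selecting columns is right multiplication by a 0-1 matrix. For \<open>k = n\<close> this
  exhibits a maximal minor as the determinant of \<open>n\<close> vectors in the image of
  \<open>M\<close>.\<close>

lemma submatrix_eq_mult:
  fixes M :: "'a :: comm_ring_1 mat"
  assumes M: "M \<in> carrier_mat n m" and J: "J \<subseteq> {..<m}" "card J = k"
  shows "\<exists>S \<in> carrier_mat m k. submatrix M {..<n} J = M * S"
proof
  define S :: "'a mat" where "S = mat m k (\<lambda>(l, j). if l = pick J j then 1 else 0)"
  show S: "S \<in> carrier_mat m k" by (simp add: S_def)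
  show "submatrix M {..<n} J = M * S"
  proof (rule eq_matI)
    fix i j assume "i < dim_row (M * S)" "j < dim_col (M * S)"
    then have ij: "i < n" "j < k" using M S by auto
    have "(M * S) $$ (i, j) = (\<Sum>l = 0..<m. M $$ (i, l) * (if l = pick J j then 1 else 0))"
      using M ij unfolding S_def by (simp add: scalar_prod_def)
    also have "\<dots> = (\<Sum>l = 0..<m. if l = pick J j then M $$ (i, l) else 0)"
      by (rule sum.cong) auto
    finally show "submatrix M {..<n} J $$ (i, j) = (M * S) $$ (i, j)"
      using submatrix_all_rows(2,3)[OF M J] ij by simp
  qed (use submatrix_all_rows(1)[OF M J] M S in auto)
qed

lemma det_ideal_generators:
  assumes M: "M \<in> carrier_mat n m"
  shows "det_ideal n M = ideal.span {det (submatrix M {..<n} J) | J. J \<subseteq> {..<m} \<and> card J = n}"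
proof -
  have I: "I \<subseteq> {..<n} \<and> card I = n \<longleftrightarrow> I = {..<n}" for I
    using card_subset_eq[of "{..<n}" I] by auto
  have "{det (submatrix M I J) | I J. I \<subseteq> {..<dim_row M} \<and> J \<subseteq> {..<dim_col M} \<and> card I = n \<and> card J = n} =
      {det (submatrix M I J) | I J. (I \<subseteq> {..<n} \<and> card I = n) \<and> J \<subseteq> {..<m} \<and> card J = n}"
    using M by (intro Collect_cong) auto
  also have "\<dots> = {det (submatrix M {..<n} J) | J. J \<subseteq> {..<m} \<and> card J = n}"
    unfolding I by (intro Collect_cong) auto
  finally have "{det (submatrix M I J) | I J. I \<subseteq> {..<dim_row M} \<and> J \<subseteq> {..<dim_col M} \<and> card I = n \<and> card J = n} =
      {det (submatrix M {..<n} J) | J. J \<subseteq> {..<m} \<and> card J = n}" .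
  then show ?thesis unfolding det_ideal_def by simp
qed

text \<open>For a maximal minor with matrix \<open>N = M S\<close>, the product of \<open>N\<close>
  and its adjugate is \<open>det N\<close>, so \<open>det N\<close> times \<open>v\<close> is
  \<open>M\<close> applied to a vector. The scalars that carry all vectors into the image form an
  ideal, so the property passes from the minors to the determinantal ideal.\<close>

lemma det_smult_in_col_span:
  fixes M :: "'a :: comm_ring_1 mat"
  assumes M: "M \<in> carrier_mat n m" and d: "d \<in> det_ideal n M" and v: "v \<in> carrier_vec n"
  shows "d \<cdot>\<^sub>v v \<in> col_span M"
proof -
  let ?I = "{d. \<forall>v \<in> carrier_vec n. d \<cdot>\<^sub>v v \<in> col_span M}"
  have z: "0\<^sub>v n \<in> col_span M"
    using M unfolding col_span_def by (intro image_eqI[of _ _ "0\<^sub>v m"]) auto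
  have "ideal.subspace ?I"
    unfolding ideal.subspace_def
  proof (intro conjI ballI allI CollectI)
    fix v :: "'a vec" assume "v \<in> carrier_vec n"
    then have "0 \<cdot>\<^sub>v v = 0\<^sub>v n" by (intro eq_vecI) auto
    then show "0 \<cdot>\<^sub>v v \<in> col_span M" using z by simp
  next
    fix x y and v :: "'a vec" assume "x \<in> ?I" "y \<in> ?I" "v \<in> carrier_vec n"
    then show "(x + y) \<cdot>\<^sub>v v \<in> col_span M"
      by (subst add_smult_distrib_vec) (auto intro: col_span_add[OF M])
  next
    fix c x and v :: "'a vec" assume "x \<in> ?I" "v \<in> carrier_vec n"
    then show "(c * x) \<cdot>\<^sub>v v \<in> col_span M"
      by (subst smult_smult_assoc[symmetric]) (auto intro: col_span_smult[OF M])
  qed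
  moreover have "det (submatrix M {..<n} J) \<in> ?I" if J: "J \<subseteq> {..<m}" "card J = n" for J
  proof (intro CollectI ballI)
    fix v :: "'a vec" assume v: "v \<in> carrier_vec n"
    let ?N = "submatrix M {..<n} J"
    obtain S where S: "S \<in> carrier_mat m n" "?N = M * S" using submatrix_eq_mult[OF M J] by blast
    have N: "?N \<in> carrier_mat n n" by (rule submatrix_all_rows(1)[OF M J])
    note adj = adj_mat[OF N]
    have "det ?N \<cdot>\<^sub>v v = (det ?N \<cdot>\<^sub>m 1\<^sub>m n) *\<^sub>v v"
    proof (rule eq_vecI)
      fix i assume "i < dim_vec ((det ?N \<cdot>\<^sub>m 1\<^sub>m n) *\<^sub>v v)"
      then have i: "i < n" by simp
      have "row (det ?N \<cdot>\<^sub>m 1\<^sub>m n) i = det ?N \<cdot>\<^sub>v unit_vec n i" using i by (intro eq_vecI) auto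
      then show "(det ?N \<cdot>\<^sub>v v) $ i = ((det ?N \<cdot>\<^sub>m 1\<^sub>m n) *\<^sub>v v) $ i" using i v by simp
    qed (use v in auto)
    also have "\<dots> = M *\<^sub>v (S *\<^sub>v (adj_mat ?N *\<^sub>v v))"
    proof -
      have "(?N * adj_mat ?N) *\<^sub>v v = ?N *\<^sub>v (adj_mat ?N *\<^sub>v v)"
        using N adj(1) v by (rule assoc_mult_mat_vec)
      also have "\<dots> = M *\<^sub>v (S *\<^sub>v (adj_mat ?N *\<^sub>v v))"
        unfolding S(2) using M S(1) adj(1) v
        by (intro assoc_mult_mat_vec) (auto simp: S(2)[symmetric] intro: mult_mat_vec_carrier)
      finally show ?thesis unfolding adj(2) .
    qed
    also have "\<dots> \<in> col_span M"
      using M S(1) adj(1) v unfolding col_span_def by (intro imageI) (auto intro!: mult_mat_vec_carrier)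
    finally show "det ?N \<cdot>\<^sub>v v \<in> col_span M" .
  qed
  ultimately have "det_ideal n M \<subseteq> ?I"
    unfolding det_ideal_generators[OF M] by (intro ideal.span_minimal) auto
  with d v show ?thesis by blast
qed

text \<open>A repeated column makes the determinant vanish; otherwise the selection is an increasing
  one up to a permutation, which changes only the sign. Columns of \<open>M\<close> are written as
  rows because the expansion of the determinant that relies on this is multilinear in rows.\<close>

lemma det_selected_columns_in_det_ideal:
  fixes M :: "'a :: comm_ring_1 mat"
  assumes M: "M \<in> carrier_mat n m" and f: "\<And>i. i < n \<Longrightarrow> f i < m"
  shows "det (mat n n (\<lambda>(i, j). M $$ (j, f i))) \<in> det_ideal n M"
proof (cases "inj_on f {0..<n}")
  case False
  then obtain i j where ij: "i < n" "j < n" "i \<noteq> j" "f i = f j" unfolding inj_on_def by auto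
  have "det (mat n n (\<lambda>(i, j). M $$ (j, f i))) = 0"
    by (rule det_identical_rows[of _ n i j]) (use ij in auto)
  then show ?thesis unfolding det_ideal_def by (simp add: ideal.span_zero)
next
  case True
  define J where "J = f ` {0..<n}"
  have J: "J \<subseteq> {..<m}" "card J = n" using f True by (auto simp: J_def card_image)
  \<comment> \<open>The rank of \<open>f i\<close> in \<open>J\<close>, from which
    \<open>pick J\<close> recovers \<open>f i\<close>. Outside the index range
    \<open>permutes\<close> demands the identity.\<close>
  define p where "p i = (if i < n then card {a \<in> J. a < f i} else i)" for i
  have pick: "pick J (p i) = f i" if "i < n" for i
    using that unfolding p_def by (simp add: pick_card_in_set J_def)
  have pn: "p i < n" if "i < n" for i
  proof -
    have "{a \<in> J. a < f i} \<subset> J" using that by (auto simp: J_def)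
    then have "card {a \<in> J. a < f i} < card J" by (rule psubset_card_mono[rotated]) (simp add: J_def)
    then show ?thesis using that J(2) by (simp add: p_def)
  qed
  have "inj_on p {0..<n}"
    using True pick by (smt (verit) atLeastLessThan_iff inj_onD inj_onI)
  moreover have "p ` {0..<n} \<subseteq> {0..<n}" using pn by auto
  ultimately have "bij_betw p {0..<n} {0..<n}"
    by (simp add: bij_betw_def endo_inj_surj)
  then have p: "p permutes {0..<n}"
    by (rule bij_imp_permutes) (simp add: p_def)
  let ?N = "submatrix M {..<n} J"
  have N: "?N \<in> carrier_mat n n" by (rule submatrix_all_rows(1)[OF M J])
  have "mat n n (\<lambda>(i, j). M $$ (j, f i)) = mat n n (\<lambda>(i, j). transpose_mat ?N $$ (p i, j))"
    using N pn pick submatrix_all_rows(2)[OF M J] by (intro eq_matI) auto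
  also have "det \<dots> = signof p * det ?N"
    using det_permute_rows[OF _ p, of "transpose_mat ?N"] N by (simp add: det_transpose)
  also have "\<dots> \<in> det_ideal n M"
    unfolding det_ideal_generators[OF M] using J
    by (intro ideal.span_scale ideal.span_base) blast
  finally show ?thesis .
qed

text \<open>Half of the Cauchy-Binet formula: multilinear expansion in the rows of the transposed
  product, without collecting the terms that belong to the same minor.\<close>

lemma det_mult_in_det_ideal:
  fixes M :: "'a :: comm_ring_1 mat"
  assumes M: "M \<in> carrier_mat n m" and B: "B \<in> carrier_mat m n"
  shows "det (M * B) \<in> det_ideal n M"
proof -
  let ?A = "transpose_mat B" and ?C = "transpose_mat M"
  have A: "?A \<in> carrier_mat n m" and C: "?C \<in> carrier_mat m n" using M B by auto
  have "det (M * B) = det (?A * ?C)"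
    using det_transpose[of "M * B" n] transpose_mult[OF M B] M B by auto
  also have "\<dots> = (\<Sum>f | (\<forall>i\<in>{0..<n}. f i \<in> {0..<m}) \<and> (\<forall>i. i \<notin> {0..<n} \<longrightarrow> f i = i).
      det (mat\<^sub>r n n (\<lambda>i. ?A $$ (i, f i) \<cdot>\<^sub>v row ?C (f i))))"
    unfolding mat_mul_finsum_alt[OF A C]
    by (rule det_linear_rows_sum) (use C in auto)
  also have "\<dots> \<in> det_ideal n M"
    unfolding det_ideal_def
  proof (intro ideal.span_sum, fold det_ideal_def)
    fix f assume "f \<in> {f. (\<forall>i\<in>{0..<n}. f i \<in> {0..<m}) \<and> (\<forall>i. i \<notin> {0..<n} \<longrightarrow> f i = i)}"
    then have f: "\<And>i. i < n \<Longrightarrow> f i < m" by simp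
    have "det (mat\<^sub>r n n (\<lambda>i. ?A $$ (i, f i) \<cdot>\<^sub>v row ?C (f i))) =
        prod (\<lambda>i. ?A $$ (i, f i)) {0..<n} * det (mat\<^sub>r n n (\<lambda>i. row ?C (f i)))"
      using row_carrier_vec[OF f C] by (intro det_rows_mul) simp
    also have "mat\<^sub>r n n (\<lambda>i. row ?C (f i)) = mat n n (\<lambda>(i, j). M $$ (j, f i))"
      using M f by (intro eq_matI) auto
    finally show "det (mat\<^sub>r n n (\<lambda>i. ?A $$ (i, f i) \<cdot>\<^sub>v row ?C (f i))) \<in> det_ideal n M"
      using det_selected_columns_in_det_ideal[of M n m f] M f
      by (simp add: det_ideal_def ideal.span_scale)
  qed
  finally show ?thesis .
qed

section \<open>Products of lists of ideals and the determinantal ideal\<close>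

lemma ideal_prod_list_memI:
  assumes "\<And>i. i < length Is \<Longrightarrow> x i \<in> Is ! i"
  shows "(\<Prod>i<length Is. x i) \<in> ideal_prod_list Is"
  using assms
proof (induction Is arbitrary: x)
  case Nil
  then show ?case by (simp add: ideal_prod_list_def)
next
  case (Cons I Is)
  have "x 0 \<in> I" using Cons.prems[of 0] by simp
  moreover have "(\<Prod>i<length Is. x (Suc i)) \<in> ideal_prod_list Is"
    using Cons.prems[of "Suc _"] by (intro Cons.IH) simp
  ultimately show ?case
    by (simp add: ideal_prod_list_def prod.lessThan_Suc_shift ideal_mult_memI del: prod.lessThan_Suc)
qed

text \<open>The universal property of the product in terms of products of one element per factor,
  the form in which determinants of diagonal matrices arise.\<close>

lemma ideal_prod_list_least:
  assumes "fracmod.subspace K"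
    and "\<And>x. (\<And>i. i < length Is \<Longrightarrow> x i \<in> Is ! i) \<Longrightarrow> (\<Prod>i<length Is. x i) \<in> K"
  shows "ideal_prod_list Is \<subseteq> K"
  using assms
proof (induction Is arbitrary: K)
  case Nil
  from Nil.prems(2)[of "\<lambda>_. 0"] have "1 \<in> K" by simp
  then have "unit_ideal \<subseteq> K"
    unfolding unit_ideal_def by (intro fracmod.span_minimal Nil.prems) simp
  then show ?case by (simp add: ideal_prod_list_def)
next
  case (Cons I Is)
  have "ideal_mult I (ideal_prod_list Is) \<subseteq> K"
  proof (rule ideal_mult_least)
    fix x y assume x: "x \<in> I" and y: "y \<in> ideal_prod_list Is"
    have "ideal_prod_list Is \<subseteq> {z. x * z \<in> K}"
    proof (intro Cons.IH fracmod_subspace_vimage Cons.prems CollectI)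
      fix y assume y: "\<And>i. i < length Is \<Longrightarrow> y i \<in> Is ! i"
      \<comment> \<open>\<open>case_nat\<close> puts \<open>x\<close> in front of the selection
        \<open>y\<close> and shifts the indices of the latter by one.\<close>
      have "(\<Prod>i<length (I # Is). case_nat x y i) \<in> K"
        by (rule Cons.prems(2)) (use x y in \<open>auto split: nat.split\<close>)
      then show "x * (\<Prod>i<length Is. y i) \<in> K"
        by (simp add: prod.lessThan_Suc_shift del: prod.lessThan_Suc)
    qed
    with y show "x * y \<in> K" by blast
  qed (rule Cons.prems)
  then show ?case by (simp add: ideal_prod_list_def)
qed

lemma fracmod_subspace_to_fract_vimage:
  "fracmod.subspace I \<Longrightarrow> ideal.subspace {x. to_fract x \<in> I}"
  unfolding ideal.subspace_def fracmod.subspace_def by auto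

lemma ideal_prod_list_subspace [simp]: "fracmod.subspace (ideal_prod_list Is)"
  by (cases Is) (auto simp: ideal_prod_list_def unit_ideal_def)

lemma exists_preimage_columns:
  assumes A: "A \<in> carrier_mat n m" and Y: "Y \<in> carrier_mat n k" and c: "\<And>j. j < k \<Longrightarrow> col Y j \<in> col_span A"
  shows "\<exists>B \<in> carrier_mat m k. A * B = Y"
proof -
  have "\<forall>j<k. \<exists>b. b \<in> carrier_vec m \<and> A *\<^sub>v b = col Y j"
    using c A unfolding col_span_def by (metis (no_types, lifting) carrier_matD(2) imageE)
  then obtain b where b: "\<And>j. j < k \<Longrightarrow> b j \<in> carrier_vec m \<and> A *\<^sub>v b j = col Y j" by metis
  define B where "B = mat m k (\<lambda>(l, j). b j $ l)"
  have "A * B = Y"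
  proof (rule eq_matI)
    fix i j assume "i < dim_row Y" "j < dim_col Y"
    then have ij: "i < n" "j < k" using Y by auto
    have "col B j = b j" using b[OF ij(2)] ij by (intro eq_vecI) (auto simp: B_def)
    then have "(A * B) $$ (i, j) = (A *\<^sub>v b j) $ i" using ij A by (auto simp: B_def)
    also have "\<dots> = Y $$ (i, j)" using b[OF ij(2)] ij Y by auto
    finally show "(A * B) $$ (i, j) = Y $$ (i, j)" .
  qed (use A Y in \<open>auto simp: B_def\<close>)
  then show ?thesis by (intro bexI[of _ B]) (auto simp: B_def)
qed

text \<open>A diagonal matrix \<open>Y\<close> with entries from the ideals has its columns in the
  image, so \<open>Y = L M B\<close>, and the product of its diagonal is
  \<open>det L * det (M B)\<close>. Conversely, a minor is \<open>det L'\<close> times the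
  determinant of \<open>X = L M S\<close>; row \<open>i\<close> of \<open>X\<close> has its entries
  in the \<open>i\<close>-th ideal, so each Leibniz term has one factor from every ideal.\<close>

lemma det_ideal_eq_prod:
  fixes M :: "'a :: idom mat"
  assumes M: "M \<in> carrier_mat n m" and L: "L \<in> carrier_mat n n" "L' \<in> carrier_mat n n" "L' * L = 1\<^sub>m n"
    and img: "col_span (L * M) = {w \<in> carrier_vec n. \<forall>i<n. w $ i \<in> ideal.span (P i)}"
  shows "ideal_prod_list (map (\<lambda>i. to_fract ` ideal.span (P i)) [0..<n]) = to_fract ` det_ideal n M"
    (is "ideal_prod_list ?Is = _")
proof
  have A: "L * M \<in> carrier_mat n m" using L M by auto
  show "ideal_prod_list ?Is \<subseteq> to_fract ` det_ideal n M"
  proof (rule ideal_prod_list_least)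
    show "fracmod.subspace (to_fract ` det_ideal n M)"
      unfolding det_ideal_def to_fract_image_span by simp
    fix x assume "\<And>i. i < length ?Is \<Longrightarrow> x i \<in> ?Is ! i"
    then have "\<forall>i<n. \<exists>y. x i = to_fract y \<and> y \<in> ideal.span (P i)" by auto
    then obtain y where y: "\<And>i. i < n \<Longrightarrow> x i = to_fract (y i) \<and> y i \<in> ideal.span (P i)" by metis
    define Y where "Y = mat n n (\<lambda>(i, j). if i = j then y i else 0)"
    have Y: "Y \<in> carrier_mat n n" by (simp add: Y_def)
    have "col Y j \<in> col_span (L * M)" if "j < n" for j
      unfolding img using that y by (auto simp: Y_def ideal.span_zero)
    then obtain B where B: "B \<in> carrier_mat m n" "L * M * B = Y"
      using exists_preimage_columns[OF A Y] by blast
    have "det Y = prod_list (diag_mat Y)"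
      by (rule det_upper_triangular[OF _ Y]) (auto simp: Y_def)
    also have "\<dots> = (\<Prod>i<n. y i)"
      by (simp add: prod_list_diag_prod Y_def atLeast0LessThan)
    finally have "(\<Prod>i<n. y i) = det (L * (M * B))"
      using B L M by (simp add: assoc_mult_mat[of _ n n _ m _ n])
    also have "\<dots> = det L * det (M * B)" using L M B by (intro det_mult) auto
    also have "\<dots> \<in> det_ideal n M"
      using det_mult_in_det_ideal[OF M B(1)] by (simp add: det_ideal_def ideal.span_scale)
    finally have "(\<Prod>i<n. y i) \<in> det_ideal n M" .
    moreover have "(\<Prod>i<n. x i) = to_fract (\<Prod>i<n. y i)"
    proof -
      have "to_fract (\<Prod>i<k. y i) = (\<Prod>i<k. to_fract (y i))" for k by (induction k) auto
      then show ?thesis using y by simp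
    qed
    ultimately show "(\<Prod>i<length ?Is. x i) \<in> to_fract ` det_ideal n M" by simp
  qed
next
  have A: "L * M \<in> carrier_mat n m" using L M by auto
  let ?K = "{x. to_fract x \<in> ideal_prod_list ?Is}"
  have K: "ideal.subspace ?K"
    by (intro fracmod_subspace_to_fract_vimage ideal_prod_list_subspace)
  have "det (submatrix M {..<n} J) \<in> ?K" if J: "J \<subseteq> {..<m}" "card J = n" for J
  proof -
    let ?N = "submatrix M {..<n} J"
    obtain S where S: "S \<in> carrier_mat m n" "?N = M * S" using submatrix_eq_mult[OF M J] by blast
    define X where "X = L * M * S"
    have X: "X \<in> carrier_mat n n" unfolding X_def using A S by auto
    have "X $$ (i, j) \<in> ideal.span (P i)" if ij: "i < n" "j < n" for i j
    proof -
      have "L * M *\<^sub>v col S j \<in> col_span (L * M)"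
        using S(1) A L M unfolding col_span_def by (intro imageI) auto
      then have "(L * M *\<^sub>v col S j) $ i \<in> ideal.span (P i)" unfolding img using ij by blast
      then show ?thesis unfolding X_def using ij A S by auto
    qed
    then have "to_fract (\<Prod>i = 0..<n. X $$ (i, p i)) \<in> ideal_prod_list ?Is" if "p permutes {0..<n}" for p
    proof -
      have "to_fract (\<Prod>i<k. X $$ (i, p i)) = (\<Prod>i<k. to_fract (X $$ (i, p i)))" for k
        by (induction k) auto
      moreover have "(\<Prod>i<length ?Is. to_fract (X $$ (i, p i))) \<in> ideal_prod_list ?Is"
        using \<open>\<And>j i. i < n \<Longrightarrow> j < n \<Longrightarrow> X $$ (i, j) \<in> ideal.span (P i)\<close> permutes_in_image[OF that]
        by (intro ideal_prod_list_memI) auto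
      ultimately show ?thesis by (simp add: atLeast0LessThan)
    qed
    then have "det X \<in> ?K"
      unfolding det_def'[OF X]
      by (intro ideal.subspace_sum[OF K] ideal.subspace_scale[OF K]) auto
    moreover have "?N = L' * X"
    proof -
      have "L' * (L * (M * S)) = L' * L * (M * S)"
        using L M S by (intro assoc_mult_mat[symmetric]) auto
      then show ?thesis unfolding X_def using L M S
        by (simp add: assoc_mult_mat[of _ n n _ m _ n])
    qed
    ultimately show ?thesis
      using det_mult[OF L(2) X] ideal.subspace_scale[OF K] by simp
  qed
  then have "det_ideal n M \<subseteq> ?K"
    unfolding det_ideal_generators[OF M] by (intro ideal.span_minimal K) auto
  then show "to_fract ` det_ideal n M \<subseteq> ideal_prod_list ?Is" by blast
qed

subsection \<open>Normal form\<close>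

lemma pseudo_iso_map_mat:
  fixes L L' :: "'a :: idom mat"
  assumes L: "L \<in> carrier_mat n n" "L' \<in> carrier_mat n n" "L * L' = 1\<^sub>m n" "L' * L = 1\<^sub>m n"
  shows "pseudo_iso (replicate n unit_ideal) (replicate n unit_ideal) (map_mat to_fract L) (map_mat to_fract L')"
proof -
  interpret f: comm_ring_hom "to_fract :: 'a \<Rightarrow> 'a fract" by unfold_locales simp_all
  have "map_mat to_fract L * map_mat to_fract L' = 1\<^sub>m n" "map_mat to_fract L' * map_mat to_fract L = 1\<^sub>m n"
    using f.mat_hom_mult[OF L(1,2)] f.mat_hom_mult[OF L(2,1)] L(3,4) by (simp_all add: f.mat_hom_one)
  moreover have "to_fract c * x \<in> unit_ideal" if "x \<in> unit_ideal" for c :: 'a and x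
    using that unfolding unit_ideal_def by (rule fracmod.span_scale)
  ultimately show ?thesis
    using L(1,2) unfolding pseudo_iso_def by (auto simp: invertible_unit_ideal)
qed

section \<open>Invertible pseudo-matrices as isomorphisms of direct sums\<close>

lemma mult_mat_vec_in_direct_sum:
  assumes C: "C \<in> carrier_mat n m" and g: "length g = n" "\<And>I. I \<in> set g \<Longrightarrow> fracmod.subspace I"
    and h: "length h = m" and v: "v \<in> direct_sum h"
    and Cm: "\<And>i j x. i < n \<Longrightarrow> j < m \<Longrightarrow> x \<in> h ! j \<Longrightarrow> C $$ (i, j) * x \<in> g ! i"
  shows "C *\<^sub>v v \<in> direct_sum g"
proof -
  have v: "v \<in> carrier_vec m" "\<And>j. j < m \<Longrightarrow> v $ j \<in> h ! j"
    using v h unfolding direct_sum_def by auto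
  have "(C *\<^sub>v v) $ i \<in> g ! i" if i: "i < n" for i
  proof -
    have "(C *\<^sub>v v) $ i = (\<Sum>j = 0..<m. C $$ (i, j) * v $ j)"
      using C i v by (auto simp: scalar_prod_def)
    also have "\<dots> \<in> g ! i"
      using i g v(2) Cm by (intro fracmod.subspace_sum) auto
    finally show ?thesis .
  qed
  moreover have "C *\<^sub>v v \<in> carrier_vec n" using C v(1) by (rule mult_mat_vec_carrier)
  ultimately show ?thesis unfolding direct_sum_def using g(1) by simp
qed

lemma pseudo_iso_direct_sum:
  assumes "pseudo_iso h e C D"
  shows "v \<in> direct_sum e \<Longrightarrow> C *\<^sub>v v \<in> direct_sum h"
    and "w \<in> direct_sum h \<Longrightarrow> D *\<^sub>v w \<in> direct_sum e"
    and "v \<in> carrier_vec (length h) \<Longrightarrow> D *\<^sub>v (C *\<^sub>v v) = v"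
    and "w \<in> carrier_vec (length h) \<Longrightarrow> C *\<^sub>v (D *\<^sub>v w) = w"
proof -
  let ?n = "length h"
  have c: "C \<in> carrier_mat ?n ?n" "D \<in> carrier_mat ?n ?n" and l: "length e = ?n"
    and i: "C * D = 1\<^sub>m ?n" "D * C = 1\<^sub>m ?n"
    and s: "\<And>I. I \<in> set h \<Longrightarrow> fracmod.subspace I" "\<And>I. I \<in> set e \<Longrightarrow> fracmod.subspace I"
    using assms unfolding pseudo_iso_def by (auto dest: invertible_idealD(1))
  show "C *\<^sub>v v \<in> direct_sum h" if "v \<in> direct_sum e"
    using mult_mat_vec_in_direct_sum[OF c(1) _ s(1) l that] assms unfolding pseudo_iso_def by auto
  show "D *\<^sub>v w \<in> direct_sum e" if "w \<in> direct_sum h"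
    using mult_mat_vec_in_direct_sum[OF c(2) l s(2) _ that] assms unfolding pseudo_iso_def by auto
  show "D *\<^sub>v (C *\<^sub>v v) = v" if "v \<in> carrier_vec ?n"
    using assoc_mult_mat_vec[OF c(2,1) that] i that by simp
  show "C *\<^sub>v (D *\<^sub>v w) = w" if "w \<in> carrier_vec ?n"
    using assoc_mult_mat_vec[OF c that] i that by simp
qed

lemma direct_sum_replicate_unit_ideal:
  "direct_sum (replicate m unit_ideal) = map_vec to_fract ` carrier_vec m"
proof (intro equalityI subsetI)
  fix v :: "'a fract vec" assume "v \<in> direct_sum (replicate m unit_ideal)"
  then have v: "v \<in> carrier_vec m" "\<And>k. k < m \<Longrightarrow> v $ k \<in> range to_fract"
    unfolding direct_sum_def unit_ideal_eq by auto
  have "to_fract (inv_into UNIV to_fract (v $ k)) = v $ k" if "k < m" for k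
    using v(2)[OF that] by (rule f_inv_into_f)
  then have "v = map_vec to_fract (vec m (\<lambda>k. inv_into UNIV to_fract (v $ k)))"
    using v by (intro eq_vecI) auto
  then show "v \<in> map_vec to_fract ` carrier_vec m" by (rule image_eqI) simp
qed (auto simp: direct_sum_def unit_ideal_eq)

lemma map_vec_to_fract_inj: "map_vec to_fract v = map_vec to_fract w \<longleftrightarrow> v = w"
  by (auto simp: vec_eq_iff map_vec_def)

text \<open>Since all row ideals are the unit ideal, \<open>C\<close> maps the sum of the column
  ideals onto the vectors with entries in the ring. \<open>f\<close> reads these entries in the ring
  itself; it is linear and bijective because \<open>to_fract\<close> is injective.\<close>

lemma pseudo_iso_imp_module_iso:
  fixes e :: "'a :: idom fract set list"
  assumes iso: "pseudo_iso (replicate m unit_ideal) e C D"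
  shows "module_iso (direct_sum e) (carrier_vec m)"
proof -
  have l: "length e = m" and C: "C \<in> carrier_mat m m"
    using iso unfolding pseudo_iso_def by auto
  note iso_mem = pseudo_iso_direct_sum[OF iso, unfolded direct_sum_replicate_unit_ideal length_replicate]
  have "\<forall>v \<in> direct_sum e. \<exists>w. w \<in> carrier_vec m \<and> C *\<^sub>v v = map_vec to_fract w"
    using iso_mem(1) by blast
  then obtain f where f: "\<And>v. v \<in> direct_sum e \<Longrightarrow> f v \<in> carrier_vec m \<and> C *\<^sub>v v = map_vec to_fract (f v)"
    by metis
  have dc: "v \<in> carrier_vec m" if "v \<in> direct_sum e" for v
    using that l unfolding direct_sum_def by simp
  have ds: "u + v \<in> direct_sum e" "to_fract r \<cdot>\<^sub>v v \<in> direct_sum e"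
    if "u \<in> direct_sum e" "v \<in> direct_sum e" for u v r
  proof -
    have "fracmod.subspace (e ! k)" if "k < m" for k
      using iso that l unfolding pseudo_iso_def by (auto intro!: invertible_idealD(1))
    then show "u + v \<in> direct_sum e" "to_fract r \<cdot>\<^sub>v v \<in> direct_sum e"
      using that l unfolding direct_sum_def
      by (auto intro!: fracmod.subspace_add fracmod.subspace_scale[where x = "v $ _"])
  qed
  have "bij_betw f (direct_sum e) (carrier_vec m)"
  proof (rule bij_betwI')
    fix u v assume u: "u \<in> direct_sum e" and v: "v \<in> direct_sum e"
    show "f u = f v \<longleftrightarrow> u = v"
      using f[OF u] f[OF v] iso_mem(3)[OF dc[OF u]] iso_mem(3)[OF dc[OF v]] by metis
  next
    fix w :: "'a vec" assume w: "w \<in> carrier_vec m"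
    let ?v = "D *\<^sub>v map_vec to_fract w"
    have v: "?v \<in> direct_sum e" using w by (intro iso_mem(2)) auto
    have "map_vec to_fract (f ?v) = map_vec to_fract w"
      using f[OF v] iso_mem(4)[of "map_vec to_fract w"] w by simp
    then have "w = f ?v" by (simp add: map_vec_to_fract_inj)
    with v show "\<exists>v\<in>direct_sum e. w = f v" by blast
  qed (use f in auto)
  moreover have "f (u + v) = f u + f v" if u: "u \<in> direct_sum e" and v: "v \<in> direct_sum e" for u v
  proof -
    have "map_vec to_fract (f (u + v)) = C *\<^sub>v u + C *\<^sub>v v"
      using f[OF ds(1)[OF u v]] mult_add_distrib_mat_vec[OF C dc[OF u] dc[OF v]] by simp
    also have "\<dots> = map_vec to_fract (f u + f v)"
      using f[OF u] f[OF v] by (intro eq_vecI) auto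
    finally show ?thesis by (simp add: map_vec_to_fract_inj)
  qed
  moreover have "f (to_fract r \<cdot>\<^sub>v v) = r \<cdot>\<^sub>v f v" if v: "v \<in> direct_sum e" for r v
  proof -
    have "map_vec to_fract (f (to_fract r \<cdot>\<^sub>v v)) = to_fract r \<cdot>\<^sub>v (C *\<^sub>v v)"
      using f[OF ds(2)[OF v v]] mult_mat_vec_smult[OF C dc[OF v]] by simp
    also have "\<dots> = map_vec to_fract (r \<cdot>\<^sub>v f v)"
      using f[OF v] by (intro eq_vecI) auto
    finally show ?thesis by (simp add: map_vec_to_fract_inj)
  qed
  ultimately show ?thesis unfolding module_iso_def by blast
qed

text \<open>The columns from \<open>n\<close> on vanish, so only the first \<open>n\<close> rows of
  the right inverse \<open>G\<close> enter \<open>U * G\<close>, and they form a right inverse of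
  the square matrix \<open>T\<close>. The two lower blocks have no rows; they give \<open>U\<close>
  the shape that block multiplication expects.\<close>

lemma lower_trapezoidal_split:
  fixes U :: "'a :: idom fract mat"
  assumes U: "U \<in> carrier_mat n m" and low: "\<And>i j. i < n \<Longrightarrow> j < m \<Longrightarrow> i < j \<Longrightarrow> U $$ (i, j) = 0"
    and G: "G \<in> carrier_mat m n" "U * G = 1\<^sub>m n" and nm: "n \<le> m"
  defines "T \<equiv> mat n n (\<lambda>(i, j). U $$ (i, j))"
  shows "U = four_block_mat T (0\<^sub>m n (m - n)) (0\<^sub>m 0 n) (0\<^sub>m 0 (m - n))"
    and "\<exists>T' \<in> carrier_mat n n. T * T' = 1\<^sub>m n \<and> T' * T = 1\<^sub>m n"
proof -
  show "U = four_block_mat T (0\<^sub>m n (m - n)) (0\<^sub>m 0 n) (0\<^sub>m 0 (m - n))"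
    using U low nm by (intro eq_matI) (auto simp: T_def)
  have T: "T \<in> carrier_mat n n" by (simp add: T_def)
  define T' where "T' = mat n n (\<lambda>(i, j). G $$ (i, j))"
  have T': "T' \<in> carrier_mat n n" by (simp add: T'_def)
  have "T * T' = U * G"
  proof (rule eq_matI)
    fix i j assume "i < dim_row (U * G)" "j < dim_col (U * G)"
    then have ij: "i < n" "j < n" using U G by auto
    have "(U * G) $$ (i, j) = (\<Sum>l = 0..<m. U $$ (i, l) * G $$ (l, j))"
      using U G(1) ij by (simp add: scalar_prod_def)
    also have "\<dots> = (\<Sum>l = 0..<n. U $$ (i, l) * G $$ (l, j))"
      using low ij nm by (intro sum.mono_neutral_right) auto
    also have "\<dots> = (T * T') $$ (i, j)"
      using ij by (simp add: T_def T'_def scalar_prod_def)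
    finally show "(T * T') $$ (i, j) = (U * G) $$ (i, j)" by simp
  qed (use U G in \<open>auto simp: T_def T'_def\<close>)
  then have "T * T' = 1\<^sub>m n" using G by simp
  with mat_mult_left_right_inverse[OF T T' this] T'
  show "\<exists>T' \<in> carrier_mat n n. T * T' = 1\<^sub>m n \<and> T' * T = 1\<^sub>m n" by blast
qed

text \<open>
  \<open>A\<close> maps \<open>\<^bold>Z\<^sup>m\<close> onto the sum of the ideals \<open>\<langle>P i\<rangle>\<close>.  After a column reduction to \<open>[T | 0]\<close> with column
  ideals \<open>e\<close>, the matrix \<open>T\<close> maps the sum of the first \<open>n\<close> ideals of \<open>e\<close> onto the same module, so \<open>T\<^sup>-\<^sup>1\<close>
  is an invertible pseudo-matrix that clears \<open>T\<close>.
\<close>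

lemma pseudo_column_normal_form:
  fixes A :: "'a :: idom mat"
  assumes pr: "pruefer_domain TYPE('a)" and A: "A \<in> carrier_mat n m" and nm: "n \<le> m"
    and d: "d \<noteq> 0" "\<And>v. v \<in> carrier_vec n \<Longrightarrow> d \<cdot>\<^sub>v v \<in> col_span A"
    and img: "col_span A = {w \<in> carrier_vec n. \<forall>i<n. w $ i \<in> ideal.span (P i)}"
    and inv: "\<And>i. i < n \<Longrightarrow> invertible_ideal (to_fract ` ideal.span (P i))"
  shows "\<exists>\<aa> C D. pseudo_iso (replicate m unit_ideal) \<aa> C D \<and> map_mat to_fract A * C = id_zero_mat n m \<and>
    (\<forall>i<n. \<aa> ! i = to_fract ` ideal.span (P i))"
proof -
  interpret f: comm_ring_hom "to_fract :: 'a \<Rightarrow> 'a fract" by unfold_locales simp_all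
  let ?F = "map_mat to_fract A" and ?u = "replicate m unit_ideal :: 'a fract set list"
  have F: "?F \<in> carrier_mat n m" using A by simp
  have "\<forall>I \<in> set ?u. invertible_ideal I" by (simp add: invertible_unit_ideal)
  from exists_lower_trapezoidal[OF pr this, of ?F n] F
  obtain C0 D0 e where iso0: "pseudo_iso ?u e C0 D0"
    and low: "\<And>i j. i < n \<Longrightarrow> j < m \<Longrightarrow> i < j \<Longrightarrow> (?F * C0) $$ (i, j) = 0" by auto
  have C0: "C0 \<in> carrier_mat m m" and D0: "D0 \<in> carrier_mat m m" and CD: "C0 * D0 = 1\<^sub>m m"
    and e: "length e = m" "\<forall>I \<in> set e. invertible_ideal I"
    and C0m: "\<And>i j x. i < m \<Longrightarrow> j < m \<Longrightarrow> x \<in> e ! j \<Longrightarrow> C0 $$ (i, j) * x \<in> unit_ideal"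
    using iso0 unfolding pseudo_iso_def by auto
  define U where "U = ?F * C0"
  have U: "U \<in> carrier_mat n m" using F C0 by (simp add: U_def)
  have Uv: "U *\<^sub>v (D0 *\<^sub>v v) = ?F *\<^sub>v v" if "v \<in> carrier_vec m" for v
  proof -
    have "U *\<^sub>v (D0 *\<^sub>v v) = ?F *\<^sub>v (C0 *\<^sub>v (D0 *\<^sub>v v))"
      unfolding U_def using F C0 D0 that by (intro assoc_mult_mat_vec) (auto intro: mult_mat_vec_carrier)
    then show ?thesis using pseudo_iso_direct_sum(4)[OF iso0] that by simp
  qed
  \<comment> \<open>\<open>d\<close> times each unit vector has a preimage, so over the field of
    fractions \<open>B\<close> divided by \<open>d\<close> is a right inverse of \<open>A\<close>;
    carried along by \<open>D0\<close> it becomes one of \<open>U\<close>.\<close>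
  have "col (d \<cdot>\<^sub>m 1\<^sub>m n) j \<in> col_span A" if "j < n" for j
    using d(2)[of "unit_vec n j"] that by (simp add: col_smult)
  then obtain B where B: "B \<in> carrier_mat m n" "A * B = d \<cdot>\<^sub>m 1\<^sub>m n"
    using exists_preimage_columns[OF A, of "d \<cdot>\<^sub>m 1\<^sub>m n" n] by auto
  define G where "G = inverse (to_fract d) \<cdot>\<^sub>m (D0 * map_mat to_fract B)"
  have G: "G \<in> carrier_mat m n" using D0 B by (simp add: G_def)
  have "U * G = inverse (to_fract d) \<cdot>\<^sub>m (?F * (C0 * D0 * map_mat to_fract B))"
    unfolding U_def G_def using F C0 D0 B
    by (simp add: mult_smult_distrib[of _ n m _ n] assoc_mult_mat[of _ n m _ m _ n] assoc_mult_mat[of _ m m _ m _ n])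
  also have "\<dots> = inverse (to_fract d) \<cdot>\<^sub>m (map_mat to_fract (A * B))"
    using CD B f.mat_hom_mult[OF A B(1)] by simp
  also have "\<dots> = 1\<^sub>m n"
    unfolding B(2) using d(1) by (intro eq_matI) auto
  finally have UG: "U * G = 1\<^sub>m n" .
  define T where "T = mat n n (\<lambda>(i, j). U $$ (i, j))"
  have T: "T \<in> carrier_mat n n" by (simp add: T_def)
  let ?k = "m - n"
  note split = lower_trapezoidal_split[OF U low[folded U_def] G UG nm, folded T_def]
  from split(2) obtain T' where T': "T' \<in> carrier_mat n n" "T * T' = 1\<^sub>m n" "T' * T = 1\<^sub>m n" by blast
  \<comment> \<open>The identity block leaves the columns from \<open>n\<close> on, and therefore
    their ideals in \<open>e\<close>, as they are.\<close>
  define Q where "Q = four_block_mat T' (0\<^sub>m n ?k) (0\<^sub>m ?k n) (1\<^sub>m ?k)"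
  define R where "R = four_block_mat T (0\<^sub>m n ?k) (0\<^sub>m ?k n) (1\<^sub>m ?k)"
  have QR: "Q \<in> carrier_mat m m" "R \<in> carrier_mat m m"
    using T T' nm four_block_carrier_mat[OF T'(1), of "1\<^sub>m ?k" ?k ?k] four_block_carrier_mat[OF T, of "1\<^sub>m ?k" ?k ?k]
    by (auto simp: Q_def R_def)
  have "Q * R = 1\<^sub>m m" "R * Q = 1\<^sub>m m"
    unfolding Q_def R_def using T T' nm
    by (simp_all add: mult_four_block_mat[of _ n n _ ?k _ ?k _ _ n _ ?k])
  moreover have UQ: "U * Q = id_zero_mat n m"
  proof -
    have "U * Q = four_block_mat (1\<^sub>m n) (0\<^sub>m n ?k) (0\<^sub>m 0 n) (0\<^sub>m 0 ?k)"
    proof -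
      have "four_block_mat T (0\<^sub>m n ?k) (0\<^sub>m 0 n) (0\<^sub>m 0 ?k) * Q = four_block_mat
          (T * T' + 0\<^sub>m n ?k * 0\<^sub>m ?k n) (T * 0\<^sub>m n ?k + 0\<^sub>m n ?k * 1\<^sub>m ?k)
          (0\<^sub>m 0 n * T' + 0\<^sub>m 0 ?k * 0\<^sub>m ?k n) (0\<^sub>m 0 n * 0\<^sub>m n ?k + 0\<^sub>m 0 ?k * 1\<^sub>m ?k)"
        unfolding Q_def using T T' by (intro mult_four_block_mat) auto
      then show ?thesis using T T' by (simp only: split(1)[symmetric]) simp
    qed
    also have "\<dots> = id_zero_mat n m"
      using nm by (intro eq_matI) (auto simp: id_zero_mat_def)
    finally show ?thesis .
  qed
  define \<aa> where "\<aa> = map (\<lambda>i. if i < n then to_fract ` ideal.span (P i) else e ! i) [0..<m]"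
  have a: "length \<aa> = m" "\<And>i. i < n \<Longrightarrow> \<aa> ! i = to_fract ` ideal.span (P i)" "\<And>i. n \<le> i \<Longrightarrow> i < m \<Longrightarrow> \<aa> ! i = e ! i"
    using nm by (auto simp: \<aa>_def)
  have ainv: "\<forall>I \<in> set \<aa>. invertible_ideal I"
    using inv e by (auto simp: \<aa>_def)
  have zero: "0 \<in> e ! i" "0 \<in> \<aa> ! i" if "i < m" for i
    using that e a(1) ainv by (auto intro!: fracmod.subspace_0 invertible_idealD(1))
  \<comment> \<open>Column \<open>j\<close> of \<open>C0\<close> times \<open>x\<close> is a vector
    \<open>z\<close> over the ring, because the row ideals of \<open>C0\<close> are the unit ideal;
    \<open>A\<close> maps \<open>z\<close> into the image, whose \<open>i\<close>-th coordinates lie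
    in the \<open>i\<close>-th ideal.\<close>
  have Tm: "T $$ (i, j) * x \<in> \<aa> ! i" if ij: "i < n" "j < n" and x: "x \<in> e ! j" for i j x
  proof -
    have jm: "j < m" using ij nm by simp
    have "vec m (\<lambda>l. C0 $$ (l, j) * x) \<in> direct_sum ?u"
      unfolding direct_sum_def using C0m[OF _ jm x] by simp
    then obtain z where z: "z \<in> carrier_vec m" "vec m (\<lambda>l. C0 $$ (l, j) * x) = map_vec to_fract z"
      unfolding direct_sum_replicate_unit_ideal by blast
    have zl: "C0 $$ (l, j) * x = to_fract (z $ l)" if "l < m" for l
      using arg_cong[OF z(2), of "\<lambda>v. v $ l"] that z(1) by simp
    have "T $$ (i, j) * x = (\<Sum>l = 0..<m. ?F $$ (i, l) * (C0 $$ (l, j) * x))"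
      using ij jm F C0 by (simp add: T_def U_def scalar_prod_def sum_distrib_right mult.assoc)
    also have "\<dots> = to_fract ((A *\<^sub>v z) $ i)"
      using ij A z(1) zl by (simp add: scalar_prod_def)
    finally have "T $$ (i, j) * x = to_fract ((A *\<^sub>v z) $ i)" .
    moreover have "A *\<^sub>v z \<in> col_span A" using A z(1) unfolding col_span_def by auto
    ultimately show ?thesis using ij unfolding img a(2)[OF ij(1)] by auto
  qed
  \<comment> \<open>The vector with \<open>y\<close> in position \<open>j\<close> is the image under
    \<open>A\<close> of some \<open>z\<close>. \<open>D0\<close> carries \<open>z\<close> into the
    sum of the ideals in \<open>e\<close>; its first \<open>n\<close> coordinates \<open>w\<close>
    solve the system with matrix \<open>T\<close> and right-hand side \<open>x\<close> in position
    \<open>j\<close>, so \<open>w\<close> is column \<open>j\<close> of \<open>T'\<close> times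
    \<open>x\<close>.\<close>
  have T'm: "T' $$ (i, j) * x \<in> e ! i" if ij: "i < n" "j < n" and x: "x \<in> \<aa> ! j" for i j x
  proof -
    obtain y where y: "y \<in> ideal.span (P j)" "x = to_fract y" using x a(2)[OF ij(2)] by auto
    have "y \<cdot>\<^sub>v unit_vec n j \<in> col_span A"
      unfolding img using y(1) ij by (auto simp: unit_vec_def ideal.span_zero)
    then obtain z where z: "z \<in> carrier_vec m" "A *\<^sub>v z = y \<cdot>\<^sub>v unit_vec n j"
      using A unfolding col_span_def by auto
    let ?z = "map_vec to_fract z"
    have zc: "?z \<in> carrier_vec m" using z by simp
    define v where "v = D0 *\<^sub>v ?z"
    have "v \<in> direct_sum e"
      unfolding v_def using z(1) by (intro pseudo_iso_direct_sum(2)[OF iso0]) (simp add: direct_sum_replicate_unit_ideal)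
    then have De: "v $ i \<in> e ! i" and Dc: "v \<in> carrier_vec m"
      using ij nm e(1) unfolding direct_sum_def by auto
    define w where "w = vec n (\<lambda>l. v $ l)"
    have w: "w \<in> carrier_vec n" by (simp add: w_def)
    have "T *\<^sub>v w = U *\<^sub>v v"
    proof (rule eq_vecI)
      fix l assume "l < dim_vec (U *\<^sub>v v)"
      then have l: "l < n" using U by simp
      have "(U *\<^sub>v v) $ l = (\<Sum>p = 0..<m. U $$ (l, p) * v $ p)"
        using l U Dc by (simp add: scalar_prod_def)
      also have "\<dots> = (\<Sum>p = 0..<n. U $$ (l, p) * v $ p)"
        using low[folded U_def] l nm by (intro sum.mono_neutral_right) auto
      also have "\<dots> = (T *\<^sub>v w) $ l" using l by (simp add: T_def w_def scalar_prod_def)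
      finally show "(T *\<^sub>v w) $ l = (U *\<^sub>v v) $ l" by simp
    qed (use T U in auto)
    also have "\<dots> = map_vec to_fract (A *\<^sub>v z)"
      unfolding v_def Uv[OF zc] using f.mult_mat_vec_hom[OF A z(1)] by simp
    also have "\<dots> = x \<cdot>\<^sub>v unit_vec n j"
      unfolding z(2) y(2) by (intro eq_vecI) (auto simp: unit_vec_def)
    finally have Tw: "T *\<^sub>v w = x \<cdot>\<^sub>v unit_vec n j" .
    have "w = T' *\<^sub>v (T *\<^sub>v w)"
      using assoc_mult_mat_vec[OF T'(1) T w] T'(3) w by simp
    then have "w $ i = (T' *\<^sub>v (x \<cdot>\<^sub>v unit_vec n j)) $ i" unfolding Tw by (rule arg_cong)
    also have "\<dots> = T' $$ (i, j) * x"
      using ij T'(1) by simp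
    finally show ?thesis using De ij by (simp add: w_def)
  qed
  have "Q $$ (i, j) * x \<in> e ! i" if ij: "i < m" "j < m" and x: "x \<in> \<aa> ! j" for i j x
    using ij x T'(1) T'm zero a(3) by (auto simp: Q_def not_less eq_diff_iff)
  moreover have "R $$ (i, j) * x \<in> \<aa> ! i" if ij: "i < m" "j < m" and x: "x \<in> e ! j" for i j x
    using ij x T Tm zero a(3) by (auto simp: R_def not_less eq_diff_iff)
  ultimately have "pseudo_iso e \<aa> Q R"
    unfolding pseudo_iso_def using QR e a(1) ainv by (simp add: ball_Un)
  from pseudo_iso_trans[OF iso0 this] have "pseudo_iso ?u \<aa> (C0 * Q) (R * D0)" .
  moreover have "?F * (C0 * Q) = id_zero_mat n m"
    using UQ assoc_mult_mat[OF F C0 QR(1)] by (simp add: U_def)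
  ultimately show ?thesis using a(2) by blast
qed

theorem mainTheorem11:
  fixes M :: "'a :: idom mat" and n m :: nat and \<delta> :: 'a
  assumes "pruefer_domain TYPE('a)"
    and "dimension_le_1 TYPE('a)"
    and "M \<in> carrier_mat n m"
    and "det_ideal n M \<noteq> {0}"
    and "\<delta> \<in> det_ideal n M" and "\<delta> \<noteq> 0"
  shows "\<exists>\<aa> :: 'a fract set list.
    length \<aa> = m \<and>
    pseudo_equivalent (pseudo_of_mat M)
      \<lparr>row_ideals = replicate n unit_ideal, col_ideals = \<aa>, entries = id_zero_mat n m\<rparr> \<and>
    (\<forall>i. Suc i < n \<longrightarrow> \<aa> ! Suc i \<subseteq> \<aa> ! i) \<and>
    ideal_prod_list (take n \<aa>) = to_fract ` det_ideal n M \<and>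
    (\<forall>i < n. \<exists>a :: 'a. \<aa> ! i = to_fract ` ideal.span {a, \<delta>}) \<and>
    module_iso (direct_sum \<aa>) (carrier_vec m)"
proof -
  interpret f: comm_ring_hom "to_fract :: 'a \<Rightarrow> 'a fract" by unfold_locales simp_all
  note pr = assms(1) and M = assms(3)
  have zd: "zero_dimensional_quotient (ideal.span {\<delta>})"
    using assms(2,6) unfolding dimension_le_1_def by blast
  \<comment> \<open>For \<open>n > m\<close> there are no minors of size \<open>n\<close>, and the
    determinantal ideal would be zero.\<close>
  have nm: "n \<le> m"
  proof (rule ccontr)
    assume "\<not> n \<le> m"
    then have "\<not> (J \<subseteq> {..<m} \<and> card J = n)" for J
      using card_mono[of "{..<m}" J] by auto
    then have "{det (submatrix M {..<n} J) | J. J \<subseteq> {..<m} \<and> card J = n} = {}" by blast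
    then have "det_ideal n M = {0}"
      unfolding det_ideal_generators[OF M] by (simp only: ideal.span_empty)
    with assms(4) show False by simp
  qed
  have \<delta>: "\<delta> \<cdot>\<^sub>v v \<in> col_span M" if "v \<in> carrier_vec n" for v
    by (rule det_smult_in_col_span[OF M assms(5) that])
  obtain L L' a where L: "L \<in> carrier_mat n n" "L' \<in> carrier_mat n n" "L * L' = 1\<^sub>m n" "L' * L = 1\<^sub>m n"
    and img: "col_span (L * M) = {w \<in> carrier_vec n. \<forall>i<n. w $ i \<in> ideal.span {a i, \<delta>}}"
    and chain: "\<And>i. Suc i < n \<Longrightarrow> a (Suc i) \<in> ideal.span {a i, \<delta>}"
    using exists_diagonal_image[OF zd pruefer_arithmetical[OF pr] M \<delta>] by blast
  have A: "L * M \<in> carrier_mat n m" using L M by simp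
  have \<delta>A: "\<delta> \<cdot>\<^sub>v v \<in> col_span (L * M)" if "v \<in> carrier_vec n" for v
    by (rule smult_in_col_span_mult[OF L(1-3) M \<delta> that])
  \<comment> \<open>\<delta> is a generator besides \<open>a i\<close>, so these ideals are nonzero
    even if \<open>a i = 0\<close>.\<close>
  have inv: "invertible_ideal (to_fract ` ideal.span {a i, \<delta>})" for i
  proof -
    have "\<delta> \<in> ideal.span {a i, \<delta>}" by (rule ideal.span_base) simp
    with assms(6) have "ideal.span {a i, \<delta>} \<noteq> {0}" by blast
    with pr show ?thesis unfolding pruefer_domain_def by simp
  qed
  obtain \<aa> C D where iso: "pseudo_iso (replicate m unit_ideal) \<aa> C D"
    and AC: "map_mat to_fract (L * M) * C = id_zero_mat n m"
    and \<aa>: "\<And>i. i < n \<Longrightarrow> \<aa> ! i = to_fract ` ideal.span {a i, \<delta>}"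
    using pseudo_column_normal_form[OF pr A nm assms(6) \<delta>A img inv] by blast
  have len: "length \<aa> = m" and ainv: "\<forall>I \<in> set \<aa>. invertible_ideal I"
    and C: "C \<in> carrier_mat m m"
    using iso unfolding pseudo_iso_def by auto
  let ?L = "\<lparr>row_ideals = replicate n unit_ideal, col_ideals = replicate n unit_ideal, entries = map_mat to_fract L\<rparr>"
  let ?C = "\<lparr>row_ideals = replicate m unit_ideal, col_ideals = \<aa>, entries = C\<rparr>"
  let ?N = "\<lparr>row_ideals = replicate n unit_ideal, col_ideals = \<aa>, entries = id_zero_mat n m\<rparr>"
  have "is_pseudo_matrix (pseudo_of_mat M)"
  proof -
    have "to_fract c * x \<in> unit_ideal" if "x \<in> unit_ideal" for c :: 'a and x
      using that unfolding unit_ideal_def by (rule fracmod.span_scale)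
    then show ?thesis
      using M unfolding is_pseudo_matrix_def pseudo_of_mat_def by (auto simp: invertible_unit_ideal)
  qed
  moreover have "is_pseudo_matrix ?N"
  proof -
    have "0 \<in> (unit_ideal :: 'a fract set)" by (simp add: unit_ideal_def fracmod.span_zero)
    \<comment> \<open>The identity entries require \<open>\<aa> ! i\<close> to lie in the unit ideal
      for \<open>i < n\<close>; it does, being the image of an ideal of the ring.\<close>
    moreover have "x \<in> unit_ideal" if "x \<in> \<aa> ! i" "i < n" for x i
      using that \<aa> by (auto simp: unit_ideal_eq)
    ultimately show ?thesis
      unfolding is_pseudo_matrix_def using len ainv
      by (auto simp: invertible_unit_ideal id_zero_mat_def)
  qed
  moreover have "pseudo_invertible ?L"
    by (rule pseudo_iso_imp_invertible[OF pseudo_iso_map_mat[OF L]])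
  moreover have "pseudo_invertible ?C" by (rule pseudo_iso_imp_invertible[OF iso])
  moreover have "pseudo_composable ?L (pseudo_of_mat M)"
    "pseudo_composable (pseudo_mult ?L (pseudo_of_mat M)) ?C"
    using M by (auto simp: pseudo_composable_def pseudo_mult_def pseudo_of_mat_def)
  moreover have "?N = pseudo_mult (pseudo_mult ?L (pseudo_of_mat M)) ?C"
    using AC f.mat_hom_mult[OF L(1) M] by (simp add: pseudo_mult_def pseudo_of_mat_def)
  ultimately have "pseudo_equivalent (pseudo_of_mat M) ?N"
    unfolding pseudo_equivalent_def by blast
  moreover have "\<aa> ! Suc i \<subseteq> \<aa> ! i" if i: "Suc i < n" for i
  proof -
    have "ideal.span {a (Suc i), \<delta>} \<subseteq> ideal.span {a i, \<delta>}"
      using chain[OF i] by (intro ideal.span_minimal) (auto intro: ideal.span_base)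
    then show ?thesis using \<aa> i by auto
  qed
  moreover have "ideal_prod_list (take n \<aa>) = to_fract ` det_ideal n M"
  proof -
    have "take n \<aa> = map (\<lambda>i. to_fract ` ideal.span {a i, \<delta>}) [0..<n]"
      using \<aa> len nm by (intro nth_equalityI) auto
    then show ?thesis using det_ideal_eq_prod[OF M L(1,2,4) img] by simp
  qed
  moreover have "module_iso (direct_sum \<aa>) (carrier_vec m)"
    by (rule pseudo_iso_imp_module_iso[OF iso])
  ultimately show ?thesis using len \<aa> by blast
qed

end
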